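(* Let $\alpha\ge0$, $X$ a complex Banach space, $\phi\in\omega_\alpha$, $a>1$, and $\{T_n\}_{n\in\mathbb{N}_0}\subset\mathcal{B}(X)$ such that $T_0=I$ and $\|T_n\|\le C\phi(n)\le C'a^n$ for all $n\in\mathbb{N}_0$, with $C,C'>0$. The following statements are equivalent: (i) The sequence $\{T_n\}_{n\in\mathbb{N}_0}$ satisfies $$T_nT_m=\sum_{u=m}^{n+m}k^{\alpha}(n+m-u)T_u-\sum_{u=0}^{n-1}k^{\alpha}(n+m-u)T_u,\qquad n\ge 1,\ m\in\mathbb{N}_0.$$ (ii) There exists a bounded algebra homomorphism $\theta:\tau^\alpha(\phi)\to\mathcal{B}(X)$ such that $\theta(h_n^\alpha)=T_n$ for $n\in\mathbb{N}_0$. (iii) The family $\{R(\lambda)\}_{|\lambda|>a}$ defined by $$R(\lambda)x:=\frac{(\lambda-1)^\alpha}{\lambda^{\alpha+1}}\sum_{n=0}^\infty\lambda^{-n}T_nx,\qquad |\lambda|>a,\ x\in X,$$ is a pseudo-resolvent. In these cases the operator $T:=T_1-\alpha I$ satisfies $T_n=\Delta^{-\alpha}\mathcal{T}(n)$ for $n\in\mathbb{N}_0$, $\theta(e_1)=T$, $\{\lambda\in\mathbb{C}:|\lambda|>a\}\subset\rho(T)$, and $R(\lambda)=(\lambda-T)^{-1}$ for $|\lambda|>a$.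
   Context: $\mathbb{N}_0=\{0,1,2,\dots\}$. $\mathcal{B}(X)$ is the algebra of bounded linear operators on $X$; $\rho(T)$ is the resolvent set. $c_{0,0}$ is the space of complex sequences on $\mathbb{N}_0$ with finite support; $e_n(j)=\delta_{n,j}$; convolution is $(f*g)(n)=\sum_{j=0}^nf(n-j)g(j)$. For $\alpha>0$, $k^\alpha(n)=\frac{\Gamma(n+\alpha)}{\Gamma(\alpha)\Gamma(n+1)}$, and $k^0=e_0$. $\Delta^{-\alpha}\mathcal{T}(n)=\sum_{j=0}^nk^\alpha(n-j)T^j$ (with $T^0=I$). $h_n^\alpha(j)=k^\alpha(n-j)$ for $0\le j\le n$ and $h_n^\alpha(j)=0$ for $j>n$ (so $h_n^0=e_n$). The factor $\frac{(\lambda-1)^\alpha}{\lambda^{\alpha}}$ means $(1-\lambda^{-1})^\alpha$ (principal branch), the reciprocal of $\sum_{n\ge0}k^\alpha(n)\lambda^{-n}$. A family $\{R(\lambda)\}$ is a pseudo-resolvent if $R(\lambda)-R(\mu)=(\mu-\lambda)R(\lambda)R(\mu)$ for all $\lambda,\mu$ in the index set. Weyl sums and differences: for $f\in c_{0,0}$ and $\alpha>0$, $W^{-\alpha}f(n)=\sum_{j=n}^\infty k^\alpha(j-n)f(j)$ and $W^\alpha f=(-1)^m\Delta^mW^{-(m-\alpha)}f$ with $m=[\alpha]+1$, where $\Delta f(n)=f(n+1)-f(n)$; $W^0f=f$. A positive sequence $\phi$ belongs to $\omega_{\alpha,loc}$ if there is $c_\phi>0$ with $$\Big(\sum_{n=0}^j+\sum_{n=p+1}^{j+p}\Big)k^\alpha(n)\phi(j+p-n)\le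 c_\phi\,\phi(j)\phi(p),\qquad 1\le j\le p.$$ $\omega_\alpha$ is the set of nondecreasing $\phi\in\omega_{\alpha,loc}$ which are of exponential type (i.e. $\phi(n)\le Cb^n$ for some $C,b>0$) and satisfy $\inf_{n\ge0}(k^{\alpha+1}(n))^{-1}\phi(n)>0$. For $\phi\in\omega_\alpha$, $q_\phi(f)=\sum_{n=0}^\infty\phi(n)|W^\alpha f(n)|$ is a norm on $c_{0,0}$ for which convolution is continuous, and $\tau^\alpha(\phi)$ is the convolution Banach algebra obtained as the completion of $c_{0,0}$ in $q_\phi$ (for $\alpha=0$ this is the weighted space $\ell^1_\phi$ of sequences with $\sum_n\phi(n)|f(n)|<\infty$). *)

theory Defs
  imports "HOL-Analysis.Analysis"
begin

class scaleC =
  fixes scaleC :: "complex \<Rightarrow> 'a \<Rightarrow> 'a"  (infixr \<open>*\<^sub>C\<close> 75)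

class complex_normed_vector = real_normed_vector + scaleC +
  assumes scaleC_add_right: "c *\<^sub>C (x + y) = c *\<^sub>C x + c *\<^sub>C y"
    and scaleC_add_left: "(c + d) *\<^sub>C x = c *\<^sub>C x + d *\<^sub>C x"
    and scaleC_scaleC: "c *\<^sub>C d *\<^sub>C x = (c * d) *\<^sub>C x"
    and scaleR_scaleC: "r *\<^sub>R x = complex_of_real r *\<^sub>C x"
    and norm_scaleC: "norm (c *\<^sub>C x) = cmod c * norm x"

class complex_banach = complex_normed_vector + complete_space

instance complex_banach \<subseteq> banach ..

text \<open>The algebra of bounded complex-linear operators. Elements of the library type of
  bounded operators are only real-linear, so it is the subset of the complex-linear ones.\<close>

definition bounded_ops :: "('a::complex_normed_vector \<Rightarrow>\<^sub>L 'a) set" where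
  "bounded_ops = {T :: 'a \<Rightarrow>\<^sub>L 'a. \<forall>c x. T (c *\<^sub>C x) = c *\<^sub>C T x}"

definition op_power :: "('a::real_normed_vector \<Rightarrow>\<^sub>L 'a) \<Rightarrow> nat \<Rightarrow> ('a \<Rightarrow>\<^sub>L 'a)" where
  "op_power T j = ((\<lambda>S. T o\<^sub>L S) ^^ j) id_blinfun"

definition resolvent_set :: "('a::complex_normed_vector \<Rightarrow>\<^sub>L 'a) \<Rightarrow> complex set" where
  "resolvent_set T =
    {z. \<exists>S\<in>bounded_ops. \<forall>x. S (z *\<^sub>C x - T x) = x \<and> z *\<^sub>C S x - T (S x) = x}"

definition pseudo_resolvent ::
    "complex set \<Rightarrow> (complex \<Rightarrow> 'a::complex_normed_vector \<Rightarrow> 'a) \<Rightarrow> bool" where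
  "pseudo_resolvent \<Omega> R \<longleftrightarrow>
    (\<forall>z\<in>\<Omega>. \<exists>S\<in>bounded_ops. R z = blinfun_apply S) \<and>
    (\<forall>z\<in>\<Omega>. \<forall>w\<in>\<Omega>. \<forall>x. R z x - R w x = (w - z) *\<^sub>C R z (R w x))"

text \<open>The case distinction is needed because the totalized Gamma function gives
  \<open>Gamma 0 = 0\<close> and hence a zero quotient at \<open>\<alpha> = 0\<close>.\<close>

definition ces :: "real \<Rightarrow> nat \<Rightarrow> real" where
  "ces \<alpha> n = (if \<alpha> = 0 then (if n = 0 then 1 else 0)
              else Gamma (real n + \<alpha>) / (Gamma \<alpha> * Gamma (real n + 1)))"

definition cesaro_sum ::
    "real \<Rightarrow> ('a::real_normed_vector \<Rightarrow>\<^sub>L 'a) \<Rightarrow> nat \<Rightarrow> ('a \<Rightarrow>\<^sub>L 'a)" where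
  "cesaro_sum \<alpha> T n = (\<Sum>j=0..n. ces \<alpha> (n - j) *\<^sub>R op_power T j)"

definition c00 :: "(nat \<Rightarrow> complex) set" where
  "c00 = {f. finite {n. f n \<noteq> 0}}"

definition unit_seq :: "nat \<Rightarrow> nat \<Rightarrow> complex" where
  "unit_seq n j = (if j = n then 1 else 0)"

definition conv :: "(nat \<Rightarrow> complex) \<Rightarrow> (nat \<Rightarrow> complex) \<Rightarrow> nat \<Rightarrow> complex" where
  "conv f g n = (\<Sum>j=0..n. f (n - j) * g j)"

definition hseq :: "real \<Rightarrow> nat \<Rightarrow> nat \<Rightarrow> complex" where
  "hseq \<alpha> n j = (if j \<le> n then of_real (ces \<alpha> (n - j)) else 0)"

definition fdiff :: "(nat \<Rightarrow> complex) \<Rightarrow> nat \<Rightarrow> complex" where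
  "fdiff f n = f (n + 1) - f n"

definition weyl_sum :: "real \<Rightarrow> (nat \<Rightarrow> complex) \<Rightarrow> nat \<Rightarrow> complex" where
  "weyl_sum \<alpha> f n = (\<Sum>\<^sub>\<infinity>j\<in>{n..}. of_real (ces \<alpha> (j - n)) * f j)"

definition weyl_diff :: "real \<Rightarrow> (nat \<Rightarrow> complex) \<Rightarrow> nat \<Rightarrow> complex" where
  "weyl_diff \<alpha> f n = (if \<alpha> = 0 then f n
     else (let m = nat \<lfloor>\<alpha>\<rfloor> + 1
           in (-1) ^ m * (fdiff ^^ m) (weyl_sum (real m - \<alpha>) f) n))"

definition omega_loc :: "real \<Rightarrow> (nat \<Rightarrow> real) set" where
  "omega_loc \<alpha> = {\<phi>. (\<forall>n. \<phi> n > 0) \<and>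
     (\<exists>c>0. \<forall>j p. 1 \<le> j \<and> j \<le> p \<longrightarrow>
        (\<Sum>n=0..j. ces \<alpha> n * \<phi> (j + p - n)) + (\<Sum>n=p+1..j+p. ces \<alpha> n * \<phi> (j + p - n))
          \<le> c * \<phi> j * \<phi> p)}"

definition omega :: "real \<Rightarrow> (nat \<Rightarrow> real) set" where
  "omega \<alpha> = {\<phi>. \<phi> \<in> omega_loc \<alpha> \<and> mono \<phi> \<and>
     (\<exists>C>0. \<exists>b>0. \<forall>n. \<phi> n \<le> C * b ^ n) \<and>
     (INF n. inverse (ces (\<alpha> + 1) n) * \<phi> n) > 0}"

definition qnorm :: "real \<Rightarrow> (nat \<Rightarrow> real) \<Rightarrow> (nat \<Rightarrow> complex) \<Rightarrow> real" where
  "qnorm \<alpha> \<phi> f = (\<Sum>n. \<phi> n * cmod (weyl_diff \<alpha> f n))"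

text \<open>Elements of the completion are equivalence classes of Cauchy sequences in \<open>c00\<close>,
  where two Cauchy sequences are identified when the norm of their difference tends to zero.\<close>

definition tau_cauchy :: "real \<Rightarrow> (nat \<Rightarrow> real) \<Rightarrow> (nat \<Rightarrow> nat \<Rightarrow> complex) set" where
  "tau_cauchy \<alpha> \<phi> = {u. (\<forall>k. u k \<in> c00) \<and>
     (\<forall>\<epsilon>>0. \<exists>N. \<forall>k\<ge>N. \<forall>l\<ge>N. qnorm \<alpha> \<phi> (\<lambda>j. u k j - u l j) < \<epsilon>)}"

definition tau_rel ::
    "real \<Rightarrow> (nat \<Rightarrow> real) \<Rightarrow> ((nat \<Rightarrow> nat \<Rightarrow> complex) \<times> (nat \<Rightarrow> nat \<Rightarrow> complex)) set" where
  "tau_rel \<alpha> \<phi> = {(u, v). u \<in> tau_cauchy \<alpha> \<phi> \<and> v \<in> tau_cauchy \<alpha> \<phi> \<and>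
     (\<lambda>k. qnorm \<alpha> \<phi> (\<lambda>j. u k j - v k j)) \<longlonglongrightarrow> 0}"

type_synonym tau_elem = "(nat \<Rightarrow> nat \<Rightarrow> complex) set"

definition tau :: "real \<Rightarrow> (nat \<Rightarrow> real) \<Rightarrow> tau_elem set" where
  "tau \<alpha> \<phi> = tau_cauchy \<alpha> \<phi> // tau_rel \<alpha> \<phi>"

definition tau_embed :: "real \<Rightarrow> (nat \<Rightarrow> real) \<Rightarrow> (nat \<Rightarrow> complex) \<Rightarrow> tau_elem" where
  "tau_embed \<alpha> \<phi> f = tau_rel \<alpha> \<phi> `` {\<lambda>k. f}"

definition tau_add :: "real \<Rightarrow> (nat \<Rightarrow> real) \<Rightarrow> tau_elem \<Rightarrow> tau_elem \<Rightarrow> tau_elem" where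
  "tau_add \<alpha> \<phi> F G = (\<Union>u\<in>F. \<Union>v\<in>G. tau_rel \<alpha> \<phi> `` {\<lambda>k j. u k j + v k j})"

definition tau_scale :: "real \<Rightarrow> (nat \<Rightarrow> real) \<Rightarrow> complex \<Rightarrow> tau_elem \<Rightarrow> tau_elem" where
  "tau_scale \<alpha> \<phi> c F = (\<Union>u\<in>F. tau_rel \<alpha> \<phi> `` {\<lambda>k j. c * u k j})"

definition tau_mult :: "real \<Rightarrow> (nat \<Rightarrow> real) \<Rightarrow> tau_elem \<Rightarrow> tau_elem \<Rightarrow> tau_elem" where
  "tau_mult \<alpha> \<phi> F G = (\<Union>u\<in>F. \<Union>v\<in>G. tau_rel \<alpha> \<phi> `` {\<lambda>k. conv (u k) (v k)})"

definition tau_norm :: "real \<Rightarrow> (nat \<Rightarrow> real) \<Rightarrow> tau_elem \<Rightarrow> real" where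
  "tau_norm \<alpha> \<phi> F = (THE l. \<forall>u\<in>F. (\<lambda>k. qnorm \<alpha> \<phi> (u k)) \<longlonglongrightarrow> l)"

definition bounded_alg_hom ::
    "real \<Rightarrow> (nat \<Rightarrow> real) \<Rightarrow> (tau_elem \<Rightarrow> ('a::complex_normed_vector \<Rightarrow>\<^sub>L 'a)) \<Rightarrow> bool" where
  "bounded_alg_hom \<alpha> \<phi> \<theta> \<longleftrightarrow>
     (\<forall>F\<in>tau \<alpha> \<phi>. \<theta> F \<in> bounded_ops) \<and>
     (\<forall>F\<in>tau \<alpha> \<phi>. \<forall>G\<in>tau \<alpha> \<phi>. \<theta> (tau_add \<alpha> \<phi> F G) = \<theta> F + \<theta> G) \<and>
     (\<forall>c. \<forall>F\<in>tau \<alpha> \<phi>. \<forall>x. \<theta> (tau_scale \<alpha> \<phi> c F) x = c *\<^sub>C \<theta> F x) \<and>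
     (\<forall>F\<in>tau \<alpha> \<phi>. \<forall>G\<in>tau \<alpha> \<phi>. \<theta> (tau_mult \<alpha> \<phi> F G) = \<theta> F o\<^sub>L \<theta> G) \<and>
     (\<exists>M. \<forall>F\<in>tau \<alpha> \<phi>. norm (\<theta> F) \<le> M * tau_norm \<alpha> \<phi> F)"

definition cesaro_functional_eq ::
    "real \<Rightarrow> (nat \<Rightarrow> ('a::real_normed_vector \<Rightarrow>\<^sub>L 'a)) \<Rightarrow> bool" where
  "cesaro_functional_eq \<alpha> T \<longleftrightarrow> (\<forall>n\<ge>1. \<forall>m.
     T n o\<^sub>L T m = (\<Sum>u=m..n+m. ces \<alpha> (n + m - u) *\<^sub>R T u)
                 - (\<Sum>u=0..n-1. ces \<alpha> (n + m - u) *\<^sub>R T u))"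

definition represents ::
    "real \<Rightarrow> (nat \<Rightarrow> real) \<Rightarrow> (nat \<Rightarrow> ('a::complex_normed_vector \<Rightarrow>\<^sub>L 'a)) \<Rightarrow>
     (tau_elem \<Rightarrow> ('a \<Rightarrow>\<^sub>L 'a)) \<Rightarrow> bool" where
  "represents \<alpha> \<phi> T \<theta> \<longleftrightarrow>
     bounded_alg_hom \<alpha> \<phi> \<theta> \<and> (\<forall>n. \<theta> (tau_embed \<alpha> \<phi> (hseq \<alpha> n)) = T n)"

text \<open>The factor \<open>(z - 1)\<^sup>\<alpha> / z\<^sup>\<alpha>\<^sup>+\<^sup>1\<close> is read as \<open>(1 - 1/z)\<^sup>\<alpha> / z\<close> with the principal branch.\<close>

definition cesaro_resolvent ::
    "real \<Rightarrow> (nat \<Rightarrow> ('a::complex_normed_vector \<Rightarrow>\<^sub>L 'a)) \<Rightarrow> complex \<Rightarrow> 'a \<Rightarrow> 'a" where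
  "cesaro_resolvent \<alpha> T z x =
     ((1 - inverse z) powr of_real \<alpha> / z) *\<^sub>C (\<Sum>n. (inverse z ^ n) *\<^sub>C T n x)"

end

theory Submission
  imports Defs
begin

text \<open>With \<open>S = T 1 - \<alpha> I\<close>, each of the three conditions is equivalent to the one-step recurrence
  \<open>T (n + 1) = S T n + k (n + 1) I\<close>, where \<open>k\<close> are the Cesaro numbers of order \<open>\<alpha>\<close>; iterating it
  gives \<open>T n = \<Sum>j\<le>n. k (n - j) S ^ j\<close>. The functional equation with \<open>n = 1\<close> is the recurrence, and
  the general case follows by induction on \<open>n\<close>, using only \<open>k 0 = 1\<close>. The sequences \<open>h n\<close> satisfy
  the same recurrence under convolution with \<open>e 1 = h 1 - \<alpha> h 0\<close>, so every homomorphism transports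
  it to \<open>T\<close>. Conversely, the Weyl difference maps \<open>h n\<close> to \<open>e n\<close>, so \<open>f = \<Sum>n. W f n h n\<close> for finitely
  supported \<open>f\<close>; the formula \<open>\<theta> f = \<Sum>n. W f n T n\<close> is bounded for the norm, multiplicative
  because \<open>T\<close> and \<open>h\<close> obey the same product formula, and extends to the completion. The weight condition is
  exactly what the product formula needs to make convolution continuous. Finally, the recurrence
  says that the generating function of \<open>T\<close> times \<open>I - w S\<close> is \<open>(1 - w) powr (-\<alpha>)\<close>, that is,
  \<open>R(\<lambda>) = (\<lambda> - S)\<^sup>-\<^sup>1\<close>.\<close>

section \<open>Operators as a complex normed space\<close>

text \<open>Generating functions at complex points are summed in operator norm, so operators need
  complex multiples. Letting the scalar act on values makes sense for every element of the type,
  including the merely real-linear ones.\<close>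

instantiation blinfun :: (real_normed_vector, complex_normed_vector) complex_normed_vector
begin

definition scaleC_blinfun :: "complex \<Rightarrow> ('a \<Rightarrow>\<^sub>L 'b) \<Rightarrow> 'a \<Rightarrow>\<^sub>L 'b" where
  "scaleC_blinfun c T = Blinfun (\<lambda>x. c *\<^sub>C T x)"

lemma scaleC_blinfun_apply: "blinfun_apply (c *\<^sub>C T) x = c *\<^sub>C T x"
  for T :: "'a \<Rightarrow>\<^sub>L 'b"
proof -
  have "bounded_linear (\<lambda>x. c *\<^sub>C T x)"
  proof (rule bounded_linear_intro[where K = "cmod c * norm T"])
    fix r x
    show "c *\<^sub>C T (r *\<^sub>R x) = r *\<^sub>R c *\<^sub>C T x"
      by (simp add: blinfun.scaleR_right scaleR_scaleC scaleC_scaleC mult.commute)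
    show "norm (c *\<^sub>C T x) \<le> norm x * (cmod c * norm T)"
      using mult_left_mono[OF norm_blinfun[of T x], of "cmod c"]
      by (simp add: norm_scaleC mult_ac)
  qed (simp add: blinfun.add_right scaleC_add_right)
  then show ?thesis
    by (simp add: scaleC_blinfun_def bounded_linear_Blinfun_apply)
qed

instance
proof
  fix c d :: complex and r :: real and S T :: "'a \<Rightarrow>\<^sub>L 'b"
  show "c *\<^sub>C (S + T) = c *\<^sub>C S + c *\<^sub>C T"
    by (rule blinfun_eqI) (simp add: scaleC_blinfun_apply blinfun.add_left scaleC_add_right)
  show "(c + d) *\<^sub>C T = c *\<^sub>C T + d *\<^sub>C T"
    by (rule blinfun_eqI) (simp add: scaleC_blinfun_apply blinfun.add_left scaleC_add_left)
  show assoc: "c *\<^sub>C d *\<^sub>C T = (c * d) *\<^sub>C T" for c d and T :: "'a \<Rightarrow>\<^sub>L 'b"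
    by (rule blinfun_eqI) (simp add: scaleC_blinfun_apply scaleC_scaleC)
  show real: "r *\<^sub>R T = complex_of_real r *\<^sub>C T" for r and T :: "'a \<Rightarrow>\<^sub>L 'b"
    by (rule blinfun_eqI) (simp add: scaleC_blinfun_apply blinfun.scaleR_left scaleR_scaleC)
  have le: "norm (c *\<^sub>C T) \<le> cmod c * norm T" for c and T :: "'a \<Rightarrow>\<^sub>L 'b"
  proof (rule norm_blinfun_bound)
    fix x
    show "norm ((c *\<^sub>C T) x) \<le> cmod c * norm T * norm x"
      using mult_left_mono[OF norm_blinfun[of T x], of "cmod c"]
      by (simp add: scaleC_blinfun_apply norm_scaleC mult_ac)
  qed simp
  show "norm (c *\<^sub>C T) = cmod c * norm T"
  proof (cases "c = 0")
    case False
    \<comment> \<open>The reverse inequality is the bound \<open>le\<close> applied to the inverse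
      scalar.\<close>
    have "T = inverse c *\<^sub>C c *\<^sub>C T"
      using False assoc[of "inverse c" c T] real[of 1 T] by simp
    then have "norm T \<le> cmod (inverse c) * norm (c *\<^sub>C T)"
      using le[of "inverse c" "c *\<^sub>C T"] by simp
    with False have "cmod c * norm T \<le> norm (c *\<^sub>C T)"
      by (simp add: norm_inverse norm_divide divide_simps mult.commute)
    with le[of c T] show ?thesis by simp
  qed (use le[of c T] in simp)
qed

end

instance blinfun :: (real_normed_vector, complex_banach) complex_banach ..

lemma scaleC_one [simp]: "1 *\<^sub>C x = x" for x :: "'a::complex_normed_vector"
  using scaleR_scaleC[of 1 x] by simp

lemma scaleC_zero_left [simp]: "0 *\<^sub>C x = 0" for x :: "'a::complex_normed_vector"
  using scaleR_scaleC[of 0 x] by simp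

interpretation scaleC: bounded_bilinear "(*\<^sub>C) :: complex \<Rightarrow> 'a \<Rightarrow> 'a::complex_normed_vector"
proof
  fix r :: real and c d :: complex and x y :: 'a
  show "(c + d) *\<^sub>C x = c *\<^sub>C x + d *\<^sub>C x" "c *\<^sub>C (x + y) = c *\<^sub>C x + c *\<^sub>C y"
    by (simp_all add: scaleC_add_left scaleC_add_right)
  show "(r *\<^sub>R c) *\<^sub>C x = r *\<^sub>R c *\<^sub>C x" "c *\<^sub>C (r *\<^sub>R x) = r *\<^sub>R c *\<^sub>C x"
    by (simp_all add: scaleR_scaleC scaleC_scaleC scaleR_conv_of_real mult.commute)
  show "\<exists>K. \<forall>c (x::'a). norm (c *\<^sub>C x) \<le> norm c * norm x * K"
    by (rule exI[of _ 1]) (simp add: norm_scaleC)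
qed

interpretation blinfun_compose: bounded_bilinear "(o\<^sub>L)"
  by (rule bounded_bilinear_blinfun_compose)

lemma id_blinfun_compose [simp]: "id_blinfun o\<^sub>L T = T" "T o\<^sub>L id_blinfun = T"
  by (simp_all add: blinfun_eqI)

lemma blinfun_compose_assoc: "(R o\<^sub>L S) o\<^sub>L T = R o\<^sub>L (S o\<^sub>L T)"
  by (simp add: blinfun_eqI)

lemma scaleC_blinfun_compose_left: "(c *\<^sub>C S) o\<^sub>L T = c *\<^sub>C (S o\<^sub>L T)"
  by (rule blinfun_eqI) (simp add: scaleC_blinfun_apply)

text \<open>Scalars act on values, so extracting one from the right factor moves it through
  \<open>S\<close>: here complex-linearity enters.\<close>

lemma scaleC_blinfun_compose_right: "S \<in> bounded_ops \<Longrightarrow> S o\<^sub>L (c *\<^sub>C T) = c *\<^sub>C (S o\<^sub>L T)"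
  by (rule blinfun_eqI) (simp add: scaleC_blinfun_apply bounded_ops_def)

lemma scaleC_in_bounded_ops: "T \<in> bounded_ops \<Longrightarrow> c *\<^sub>C T \<in> bounded_ops"
  by (simp add: bounded_ops_def scaleC_blinfun_apply scaleC_scaleC mult.commute)

lemma add_in_bounded_ops: "S \<in> bounded_ops \<Longrightarrow> T \<in> bounded_ops \<Longrightarrow> S + T \<in> bounded_ops"
  by (simp add: bounded_ops_def blinfun.add_left scaleC_add_right)

lemma zero_in_bounded_ops: "0 \<in> bounded_ops"
  by (simp add: bounded_ops_def scaleC.zero_right)

lemma sum_in_bounded_ops: "(\<And>i. i \<in> I \<Longrightarrow> T i \<in> bounded_ops) \<Longrightarrow> sum T I \<in> bounded_ops"
  by (induction I rule: infinite_finite_induct) (auto intro: zero_in_bounded_ops add_in_bounded_ops)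

text \<open>Evaluation at a point is continuous for the operator norm, so each linearity condition
  is closed. This keeps sums of series and limits along Cauchy sequences complex-linear.\<close>

lemma closed_bounded_ops: "closed (bounded_ops :: ('a::complex_normed_vector \<Rightarrow>\<^sub>L 'a) set)"
proof -
  have "closed {T :: 'a \<Rightarrow>\<^sub>L 'a. T (c *\<^sub>C x) = c *\<^sub>C T x}" for c x
    by (intro closed_Collect_eq continuous_intros scaleC.continuous_on)
  then show ?thesis
    unfolding bounded_ops_def Collect_all_eq by (intro closed_INT) auto
qed

lemma suminf_in_bounded_ops:
  assumes "summable T" "\<And>n. T n \<in> bounded_ops"
  shows "suminf T \<in> bounded_ops"
proof (rule closed_sequentially[OF closed_bounded_ops])
  show "(\<lambda>n. \<Sum>i<n. T i) \<longlonglongrightarrow> suminf T"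
    using assms(1) by (rule summable_LIMSEQ)
qed (simp add: sum_in_bounded_ops assms(2))

section \<open>Cesaro numbers\<close>

text \<open>One formula that covers \<alpha> = 0 as well, replacing the case distinction in
  \<open>ces\<close>.\<close>

lemma ces_pochhammer:
  assumes "\<alpha> \<ge> 0"
  shows "ces \<alpha> n = pochhammer \<alpha> n / fact n"
proof (cases "\<alpha> = 0")
  case False
  with assms have "\<alpha> \<notin> \<int>\<^sub>\<le>\<^sub>0" by (auto elim!: nonpos_Ints_cases)
  then show ?thesis
    using False Gamma_fact[of n, where 'a = real]
    by (simp add: ces_def pochhammer_Gamma add_ac)
qed (auto simp: ces_def pochhammer_0_left)

lemma ces_gbinomial: "\<alpha> \<ge> 0 \<Longrightarrow> ces \<alpha> n = (-1) ^ n * ((-\<alpha>) gchoose n)"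
  by (simp add: ces_pochhammer gbinomial_pochhammer flip: power_mult_distrib mult.assoc)

lemma ces_0_right [simp]: "\<alpha> \<ge> 0 \<Longrightarrow> ces \<alpha> 0 = 1"
  by (simp add: ces_pochhammer)

lemma ces_Suc_0 [simp]: "\<alpha> \<ge> 0 \<Longrightarrow> ces \<alpha> (Suc 0) = \<alpha>"
  by (simp add: ces_pochhammer)

lemma ces_nonneg: "\<alpha> \<ge> 0 \<Longrightarrow> ces \<alpha> n \<ge> 0"
  by (cases "\<alpha> = 0") (simp_all add: ces_pochhammer pochhammer_nonneg pochhammer_0_left)

text \<open>Convolution adds the orders of the kernels. In binomial form this is the Vandermonde
  identity with negative upper arguments, the signs combining to \<open>(-1) ^ n\<close>.\<close>

lemma ces_Vandermonde:
  assumes "\<alpha> \<ge> 0" "\<beta> \<ge> 0"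
  shows "(\<Sum>j=0..n. ces \<alpha> j * ces \<beta> (n - j)) = ces (\<alpha> + \<beta>) n"
proof -
  have "(\<Sum>j=0..n. ces \<alpha> j * ces \<beta> (n - j))
      = (\<Sum>j=0..n. (-1) ^ n * (((-\<alpha>) gchoose j) * ((-\<beta>) gchoose (n - j))))"
    using assms by (intro sum.cong refl) (simp add: ces_gbinomial power_add[symmetric])
  also have "\<dots> = ces (\<alpha> + \<beta>) n"
    using assms gbinomial_Vandermonde[of "-\<alpha>" "-\<beta>" n]
    by (simp add: ces_gbinomial flip: sum_distrib_left)
  finally show ?thesis .
qed

text \<open>The kernel of order 1 is constantly 1, so raising the order by one means taking partial
  sums.\<close>

lemma ces_diff:
  assumes "\<alpha> \<ge> 0"
  shows "ces (\<alpha> + 1) (Suc n) - ces (\<alpha> + 1) n = ces \<alpha> (Suc n)"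
proof -
  have "ces 1 j = 1" for j
    by (simp add: ces_pochhammer pochhammer_fact[symmetric])
  then have "ces (\<alpha> + 1) n = (\<Sum>j=0..n. ces \<alpha> j)" for n
    using ces_Vandermonde[of \<alpha> 1 n] assms by simp
  then show ?thesis by simp
qed

text \<open>The generalized binomial series with exponent -\<alpha> at the point -w.\<close>

lemma ces_sums:
  assumes "\<alpha> \<ge> 0" "cmod w < 1"
  shows "(\<lambda>n. w ^ n * of_real (ces \<alpha> n)) sums ((1 - w) powr (- of_real \<alpha>))"
proof -
  have "of_real (ces \<alpha> n) = (-1) ^ n * ((- of_real \<alpha>) gchoose n :: complex)" for n
    using assms(1)
    by (simp add: ces_pochhammer gbinomial_pochhammer pochhammer_of_real flip: power_mult_distrib mult.assoc)
  then have "w ^ n * of_real (ces \<alpha> n) = ((- of_real \<alpha>) gchoose n) * (-w) ^ n" for n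
    by (simp add: power_minus[of w])
  then show ?thesis
    using gen_binomial_complex[of "-w" "- of_real \<alpha>"] assms(2) by simp
qed

lemma ces_sums_real:
  assumes "\<alpha> \<ge> 0" "\<bar>t\<bar> < 1"
  shows "(\<lambda>n. t ^ n * ces \<alpha> n) sums ((1 - t) powr (- \<alpha>))"
proof -
  have "(\<lambda>n. complex_of_real (t ^ n * ces \<alpha> n)) sums (complex_of_real (1 - t) powr (of_real (- \<alpha>)))"
    using ces_sums[of \<alpha> "of_real t"] assms by simp
  then have "(\<lambda>n. complex_of_real (t ^ n * ces \<alpha> n)) sums complex_of_real ((1 - t) powr (- \<alpha>))"
    using assms(2) powr_of_real[of "1 - t" "-\<alpha>"] by simp
  then show ?thesis by (simp only: sums_of_real_iff)
qed

section \<open>The functional equation and the recurrence\<close>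

text \<open>Abstract kernel and values let one calculation serve both the operators
  \<open>T n\<close> and the entries of the sequences \<open>hseq\<close>. The second sum runs over
  \<open>u<n\<close>, hence is empty at n = 0, where \<open>0..n - 1\<close> would still contain
  0.\<close>

definition cesaro_product_rhs :: "(nat \<Rightarrow> real) \<Rightarrow> (nat \<Rightarrow> 'b::real_vector) \<Rightarrow> nat \<Rightarrow> nat \<Rightarrow> 'b" where
  "cesaro_product_rhs k H n m =
     (\<Sum>u=m..n+m. k (n + m - u) *\<^sub>R H u) - (\<Sum>u<n. k (n + m - u) *\<^sub>R H u)"

lemma cesaro_product_rhs_0: "k 0 = 1 \<Longrightarrow> cesaro_product_rhs k H 0 m = H m"
  by (simp add: cesaro_product_rhs_def)

text \<open>The induction step for both product formulas, with \<open>G\<close> in the role of the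
  image of \<open>H\<close> under the one-step operator. After an index shift the terms in
  \<open>H 0\<close> cancel, because \<open>A\<close> and \<open>B\<close> differ by exactly the
  boundary coefficient of the second sum.\<close>

lemma cesaro_product_rhs_shift:
  assumes k0: "k 0 = 1"
    and G: "\<And>u. G u = H (Suc u) - k (Suc u) *\<^sub>R H 0"
  shows "cesaro_product_rhs k H (Suc n) m = cesaro_product_rhs k G n m + k (Suc n) *\<^sub>R H m"
proof -
  define A where "A = (\<Sum>u=m..n+m. k (n + m - u) * k (Suc u))"
  define B where "B = (\<Sum>u<n. k (n + m - u) * k (Suc u))"
  \<comment> \<open>Reflection u -> n + m - u turns \<open>A\<close> into the terms of
    \<open>B\<close> plus the term at v = 0, where \<open>k 0\<close> is 1.\<close>
  have "A = (\<Sum>v<Suc n. k v * k (Suc (n + m) - v))"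
    unfolding A_def
    by (rule sum.reindex_bij_witness[where i = "\<lambda>v. n + m - v" and j = "\<lambda>u. n + m - u"])
       (auto simp: Suc_diff_le)
  also have "\<dots> = k (Suc (n + m)) + (\<Sum>v<n. k (Suc v) * k (n + m - v))"
    by (subst sum.lessThan_Suc_shift) (simp add: k0)
  finally have AB: "A = k (Suc (n + m)) + B"
    by (simp add: B_def mult.commute)
  have "(\<Sum>u=m..n+m. k (n + m - u) *\<^sub>R G u)
      = (\<Sum>u=m..n+m. k (Suc n + m - Suc u) *\<^sub>R H (Suc u)) - A *\<^sub>R H 0"
    by (simp add: G A_def scaleR_diff_right sum_subtractf scaleR_sum_left)
  also have "(\<Sum>u=m..n+m. k (Suc n + m - Suc u) *\<^sub>R H (Suc u))
      = (\<Sum>u=Suc m..Suc n+m. k (Suc n + m - u) *\<^sub>R H u)"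
    using sum.shift_bounds_cl_Suc_ivl[of "\<lambda>u. k (Suc n + m - u) *\<^sub>R H u" m "n + m"] by simp
  also have "\<dots> = (\<Sum>u=m..Suc n+m. k (Suc n + m - u) *\<^sub>R H u) - k (Suc n) *\<^sub>R H m"
    by (subst (2) sum.atLeast_Suc_atMost) auto
  finally have 1: "(\<Sum>u=m..n+m. k (n + m - u) *\<^sub>R G u) = \<dots> - A *\<^sub>R H 0" .
  have "(\<Sum>u<n. k (n + m - u) *\<^sub>R G u)
      = (\<Sum>u<n. k (Suc n + m - Suc u) *\<^sub>R H (Suc u)) - B *\<^sub>R H 0"
    by (simp add: G B_def scaleR_diff_right sum_subtractf scaleR_sum_left)
  also have "(\<Sum>u<n. k (Suc n + m - Suc u) *\<^sub>R H (Suc u))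
      = (\<Sum>u<Suc n. k (Suc n + m - u) *\<^sub>R H u) - k (Suc (n + m)) *\<^sub>R H 0"
    by (subst sum.lessThan_Suc_shift) simp
  finally show ?thesis
    unfolding cesaro_product_rhs_def 1 by (simp add: AB scaleR_add_left)
qed

text \<open>At n = 0 both sides are \<open>T m\<close>, so the equation may be taken for all n,
  which gives induction its base case.\<close>

lemma cesaro_functional_eq_iff:
  assumes "\<alpha> \<ge> 0" "T 0 = id_blinfun"
  shows "cesaro_functional_eq \<alpha> T \<longleftrightarrow>
    (\<forall>n m. T n o\<^sub>L T m = cesaro_product_rhs (ces \<alpha>) T n m)"
proof -
  have "{0..n - 1} = {..<n}" if "n \<ge> 1" for n :: nat
    using that by auto
  then have "cesaro_functional_eq \<alpha> T \<longleftrightarrow>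
      (\<forall>n\<ge>1. \<forall>m. T n o\<^sub>L T m = cesaro_product_rhs (ces \<alpha>) T n m)"
    by (simp add: cesaro_functional_eq_def cesaro_product_rhs_def cong: conj_cong imp_cong)
  moreover have "T 0 o\<^sub>L T m = cesaro_product_rhs (ces \<alpha>) T 0 m" for m
    using assms by (simp add: cesaro_product_rhs_0)
  ultimately show ?thesis
    by (metis One_nat_def Suc_leI gr0I)
qed

definition cesaro_recurrence :: "real \<Rightarrow> (nat \<Rightarrow> ('a::real_normed_vector \<Rightarrow>\<^sub>L 'a)) \<Rightarrow> bool" where
  "cesaro_recurrence \<alpha> T \<longleftrightarrow>
     (\<forall>n. T (Suc n) = ((T 1 - \<alpha> *\<^sub>R id_blinfun) o\<^sub>L T n) + ces \<alpha> (Suc n) *\<^sub>R id_blinfun)"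

lemma cesaro_functional_eq_iff_recurrence:
  assumes \<alpha>: "\<alpha> \<ge> 0" and T0: "T 0 = id_blinfun"
  shows "cesaro_functional_eq \<alpha> T \<longleftrightarrow> cesaro_recurrence \<alpha> T"
proof
  assume "cesaro_functional_eq \<alpha> T"
  then have "T 1 o\<^sub>L T m = cesaro_product_rhs (ces \<alpha>) T 1 m" for m
    by (simp only: cesaro_functional_eq_iff[of \<alpha> T, OF assms])
  then have "T 1 o\<^sub>L T m = \<alpha> *\<^sub>R T m + T (Suc m) - ces \<alpha> (Suc m) *\<^sub>R id_blinfun" for m
    by (simp add: cesaro_product_rhs_def \<alpha> T0)
  then show "cesaro_recurrence \<alpha> T"
    by (simp add: cesaro_recurrence_def blinfun_compose.diff_left blinfun_compose.scaleR_left)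
next
  define S where "S = T 1 - \<alpha> *\<^sub>R id_blinfun"
  assume "cesaro_recurrence \<alpha> T"
  then have rec: "T (Suc n) = (S o\<^sub>L T n) + ces \<alpha> (Suc n) *\<^sub>R T 0" for n
    unfolding cesaro_recurrence_def S_def T0 by blast
  have "T n o\<^sub>L T m = cesaro_product_rhs (ces \<alpha>) T n m" for n m
  proof (induction n)
    case 0
    show ?case by (simp add: \<alpha> T0 cesaro_product_rhs_0)
  next
    case (Suc n)
    have "T (Suc n) o\<^sub>L T m = (S o\<^sub>L (T n o\<^sub>L T m)) + ces \<alpha> (Suc n) *\<^sub>R T m"
      by (simp add: rec[of n] T0 blinfun_compose.add_left blinfun_compose.scaleR_left blinfun_compose_assoc)
    \<comment> \<open>\<open>S\<close> acts on every term of the induction hypothesis, and by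
      \<open>rec\<close> the family \<open>S o\<^sub>L T u\<close> is the \<open>G\<close> of
      \<open>cesaro_product_rhs_shift\<close>.\<close>
    also have "S o\<^sub>L (T n o\<^sub>L T m) = cesaro_product_rhs (ces \<alpha>) (\<lambda>u. S o\<^sub>L T u) n m"
      by (simp add: Suc cesaro_product_rhs_def blinfun_compose.diff_right blinfun_compose.sum_right
          blinfun_compose.scaleR_right)
    also have "\<dots> + ces \<alpha> (Suc n) *\<^sub>R T m = cesaro_product_rhs (ces \<alpha>) T (Suc n) m"
      by (rule cesaro_product_rhs_shift[symmetric]) (simp_all add: \<alpha> rec)
    finally show ?case .
  qed
  then show "cesaro_functional_eq \<alpha> T"
    by (simp add: cesaro_functional_eq_iff[of \<alpha> T, OF assms])
qed

lemma cesaro_sum_Suc: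
  "cesaro_sum \<alpha> S (Suc n) = (S o\<^sub>L cesaro_sum \<alpha> S n) + ces \<alpha> (Suc n) *\<^sub>R id_blinfun"
proof -
  have "cesaro_sum \<alpha> S (Suc n)
      = (\<Sum>j\<le>Suc n. ces \<alpha> (Suc n - j) *\<^sub>R op_power S j)"
    by (simp only: cesaro_sum_def atMost_atLeast0)
  also have "\<dots> = ces \<alpha> (Suc n) *\<^sub>R id_blinfun + (\<Sum>j\<le>n. ces \<alpha> (n - j) *\<^sub>R (S o\<^sub>L op_power S j))"
    by (subst sum.atMost_Suc_shift) (simp add: op_power_def)
  finally show ?thesis
    by (simp add: cesaro_sum_def atMost_atLeast0 blinfun_compose.sum_right blinfun_compose.scaleR_right)
qed

lemma cesaro_recurrence_cesaro_sum:
  assumes "\<alpha> \<ge> 0" "T 0 = id_blinfun" "cesaro_recurrence \<alpha> T"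
  shows "T n = cesaro_sum \<alpha> (T 1 - \<alpha> *\<^sub>R id_blinfun) n"
proof (induction n)
  case 0
  show ?case using assms by (simp add: cesaro_sum_def op_power_def)
next
  case (Suc n)
  then show ?case
    using assms(3) by (metis cesaro_recurrence_def cesaro_sum_Suc)
qed

text \<open>Each \<open>T n\<close> is a polynomial in
  \<open>T 1 - \<alpha> *\<^sub>R id_blinfun\<close>. Commutation will make the resolvent a
  two-sided inverse.\<close>

lemma cesaro_recurrence_commute:
  assumes T0: "T 0 = id_blinfun" and rec: "cesaro_recurrence \<alpha> T"
  shows "T n o\<^sub>L (T 1 - \<alpha> *\<^sub>R id_blinfun) = (T 1 - \<alpha> *\<^sub>R id_blinfun) o\<^sub>L T n"
    (is "_ o\<^sub>L ?S = _")
proof (induction n)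
  case (Suc n)
  have T: "T (Suc n) = (?S o\<^sub>L T n) + ces \<alpha> (Suc n) *\<^sub>R id_blinfun"
    using rec unfolding cesaro_recurrence_def by blast
  show ?case
    unfolding T blinfun_compose.add_left blinfun_compose.add_right blinfun_compose_assoc Suc
    by (simp add: blinfun_compose.scaleR_left blinfun_compose.scaleR_right)
qed (simp add: T0)

section \<open>The generating function of the family and the resolvent of S\<close>

lemma summable_powser_scaleC:
  fixes c :: "nat \<Rightarrow> 'b::complex_banach"
  assumes "\<And>n. norm (c n) \<le> K * a ^ n" "a > 0" "a * cmod w < 1"
  shows "summable (\<lambda>n. w ^ n *\<^sub>C c n)"
proof (rule summable_comparison_test'[where N = 0])
  show "summable (\<lambda>n. K * (a * cmod w) ^ n)"
    using assms by (intro summable_mult summable_geometric) simp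
  show "norm (w ^ n *\<^sub>C c n) \<le> K * (a * cmod w) ^ n" for n
    using mult_left_mono[OF assms(1), of "cmod w ^ n" n]
    by (simp add: norm_scaleC norm_power power_mult_distrib mult_ac)
qed

text \<open>Multiplying the recurrence by \<open>w ^ Suc n\<close>, where w = 1/z, and summing gives
  w S P = P - \<kappa> I for the generating function \<open>P\<close>. Since g \<kappa> = 1, scaling
  by g turns this into S R = z R - I.\<close>

lemma cesaro_resolvent_inverse:
  fixes T :: "nat \<Rightarrow> ('a::complex_banach \<Rightarrow>\<^sub>L 'a)"
  assumes \<alpha>: "\<alpha> \<ge> 0" and a: "a > 1" and T: "\<And>n. T n \<in> bounded_ops"
    and T0: "T 0 = id_blinfun" and bound: "\<And>n. norm (T n) \<le> K * a ^ n"
    and rec: "cesaro_recurrence \<alpha> T" and z: "cmod z > a"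
  defines "S \<equiv> T 1 - \<alpha> *\<^sub>R id_blinfun"
  obtains R where "R \<in> bounded_ops" "cesaro_resolvent \<alpha> T z = blinfun_apply R"
    "\<And>x. S (R x) = z *\<^sub>C R x - x" "\<And>x. R (S x) = z *\<^sub>C R x - x"
proof -
  define w where "w = inverse z"
  have [simp]: "z \<noteq> 0" using z a by auto
  have w: "a * cmod w < 1" "cmod w < 1"
    using z a by (simp_all add: w_def norm_inverse field_simps norm_divide)
  have "1 - w \<noteq> 0" using w by auto
  have summ: "summable (\<lambda>n. w ^ n *\<^sub>C T n)"
    using summable_powser_scaleC[OF bound _ w(1)] a by simp
  define P where "P = (\<Sum>n. w ^ n *\<^sub>C T n)"
  define g where "g = (1 - w) powr of_real \<alpha>"
  define \<kappa> where "\<kappa> = (1 - w) powr (- of_real \<alpha>)"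
  have g\<kappa>: "g * \<kappa> = 1"
    using \<open>1 - w \<noteq> 0\<close> by (simp add: g_def \<kappa>_def powr_minus)
  \<comment> \<open>\<open>V n\<close> will be S T n for the right inverse and T n S for the left
    inverse; both equal the same expression in \<open>T (Suc n)\<close>.\<close>
  have *: "w *\<^sub>C (\<Sum>n. w ^ n *\<^sub>C V n) = P - \<kappa> *\<^sub>C id_blinfun"
    if V: "\<And>n. V n = T (Suc n) - ces \<alpha> (Suc n) *\<^sub>R id_blinfun"
      and Vs: "summable (\<lambda>n. w ^ n *\<^sub>C V n)" for V
  proof -
    have \<kappa>: "(\<lambda>n. (w ^ n * of_real (ces \<alpha> n)) *\<^sub>C (id_blinfun :: 'a \<Rightarrow>\<^sub>L 'a)) sums (\<kappa> *\<^sub>C id_blinfun)"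
      unfolding \<kappa>_def
      by (rule bounded_linear.sums[OF scaleC.bounded_linear_left ces_sums[OF \<alpha> w(2)]])
    have "(\<lambda>n. w ^ n *\<^sub>C T n - (w ^ n * of_real (ces \<alpha> n)) *\<^sub>C (id_blinfun :: 'a \<Rightarrow>\<^sub>L 'a)) sums (P - \<kappa> *\<^sub>C id_blinfun)"
      (is "?d sums _")
      unfolding P_def by (rule sums_diff[OF summable_sums[OF summ] \<kappa>])
    \<comment> \<open>T 0 = I and k 0 = 1, so dropping the first term leaves the sum
      unchanged.\<close>
    moreover have "?d 0 = 0" by (simp add: T0 \<alpha>)
    ultimately have "(\<lambda>n. ?d (Suc n)) sums (P - \<kappa> *\<^sub>C id_blinfun)"
      using sums_Suc_iff[of ?d] by simp
    moreover have "?d (Suc n) = w *\<^sub>C (w ^ n *\<^sub>C V n)" for n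
      by (simp add: V scaleC.diff_right scaleC_scaleC scaleR_scaleC mult.assoc)
    ultimately have "(\<lambda>n. w *\<^sub>C (w ^ n *\<^sub>C V n)) sums (P - \<kappa> *\<^sub>C id_blinfun)"
      by (simp only:)
    then show ?thesis
      using bounded_linear.sums[OF scaleC.bounded_linear_right summable_sums[OF Vs], of w]
      by (rule sums_unique2[rotated])
  qed
  define R where "R = (g / z) *\<^sub>C P"
  have S: "S \<in> bounded_ops"
    using T[of 1] by (simp add: S_def bounded_ops_def blinfun.diff_left blinfun.scaleR_left
        scaleC.diff_right scaleC.scaleR_right)
  have V: "S o\<^sub>L T n = T (Suc n) - ces \<alpha> (Suc n) *\<^sub>R id_blinfun"
    and V': "T n o\<^sub>L S = T (Suc n) - ces \<alpha> (Suc n) *\<^sub>R id_blinfun" for n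
    using rec[unfolded cesaro_recurrence_def, rule_format, of n]
      cesaro_recurrence_commute[OF T0 rec, of n]
    unfolding S_def by (simp_all only: add_diff_cancel_right')
  have left: "(\<lambda>n. w ^ n *\<^sub>C (S o\<^sub>L T n)) sums (S o\<^sub>L P)"
    using bounded_linear.sums[OF blinfun_compose.bounded_linear_right summable_sums[OF summ], of S]
    by (simp add: P_def scaleC_blinfun_compose_right[OF S])
  have right: "(\<lambda>n. w ^ n *\<^sub>C (T n o\<^sub>L S)) sums (P o\<^sub>L S)"
    using bounded_linear.sums[OF blinfun_compose.bounded_linear_left summable_sums[OF summ], of S]
    by (simp add: P_def scaleC_blinfun_compose_left)
  have eq: "(g / z) *\<^sub>C X = z *\<^sub>C R - id_blinfun" if "w *\<^sub>C X = P - \<kappa> *\<^sub>C id_blinfun" for X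
  proof -
    have "(g / z) *\<^sub>C X = g *\<^sub>C w *\<^sub>C X"
      by (simp add: w_def scaleC_scaleC divide_inverse)
    then show ?thesis
      by (simp add: that scaleC.diff_right scaleC_scaleC g\<kappa> R_def)
  qed
  have "w *\<^sub>C (S o\<^sub>L P) = P - \<kappa> *\<^sub>C id_blinfun"
    using *[OF V sums_summable[OF left]] sums_unique[OF left] by simp
  then have SR: "S o\<^sub>L R = z *\<^sub>C R - id_blinfun"
    by (simp add: R_def scaleC_blinfun_compose_right[OF S] eq[unfolded R_def])
  have "w *\<^sub>C (P o\<^sub>L S) = P - \<kappa> *\<^sub>C id_blinfun"
    using *[OF V' sums_summable[OF right]] sums_unique[OF right] by simp
  then have RS: "R o\<^sub>L S = z *\<^sub>C R - id_blinfun"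
    by (simp add: R_def scaleC_blinfun_compose_left eq[unfolded R_def])
  show thesis
  proof
    show "R \<in> bounded_ops"
      unfolding R_def P_def by (intro scaleC_in_bounded_ops suminf_in_bounded_ops summ T)
    have "P x = (\<Sum>n. w ^ n *\<^sub>C T n x)" for x
      using bounded_linear.suminf[OF blinfun.bounded_linear_left summ, of x]
      by (simp add: P_def scaleC_blinfun_apply)
    then show "cesaro_resolvent \<alpha> T z = blinfun_apply R"
      by (intro ext) (simp add: cesaro_resolvent_def R_def scaleC_blinfun_apply g_def w_def)
    show "S (R x) = z *\<^sub>C R x - x" "R (S x) = z *\<^sub>C R x - x" for x
      using arg_cong[OF SR, of "\<lambda>Q. blinfun_apply Q x"] arg_cong[OF RS, of "\<lambda>Q. blinfun_apply Q x"]
      by (simp_all add: blinfun.diff_left scaleC_blinfun_apply)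
  qed
qed

section \<open>Vector-valued power series at small positive arguments\<close>

lemma summable_powser_scaleR:
  fixes c :: "nat \<Rightarrow> 'b::banach"
  assumes "\<And>n. norm (c n) \<le> K * a ^ n" "a > 0" "a * \<bar>t\<bar> < 1"
  shows "summable (\<lambda>n. t ^ n *\<^sub>R c n)"
proof (rule summable_comparison_test'[where N = 0])
  show "summable (\<lambda>n. K * (a * \<bar>t\<bar>) ^ n)"
    using assms by (intro summable_mult summable_geometric) simp
  show "norm (t ^ n *\<^sub>R c n) \<le> K * (a * \<bar>t\<bar>) ^ n" for n
    using mult_left_mono[OF assms(1), of "\<bar>t\<bar> ^ n" n]
    by (simp add: power_abs power_mult_distrib mult_ac)
qed

lemma powser_tendsto_at_0:
  fixes c :: "nat \<Rightarrow> 'b::banach"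
  assumes bound: "\<And>n. norm (c n) \<le> K * a ^ n" and "a > 0"
  shows "((\<lambda>t. \<Sum>n. t ^ n *\<^sub>R c n) \<longlongrightarrow> c 0) (at_right 0)"
proof -
  have K: "K \<ge> 0"
    using order_trans[OF norm_ge_zero bound[of 0]] by simp
  \<comment> \<open>Below 1/(2a) the ratio t a is under 1/2, so the geometric tail is at most twice
    its first term.\<close>
  define r where "r = 1 / (2 * a)"
  have "r > 0" using \<open>a > 0\<close> by (simp add: r_def)
  have "norm ((\<Sum>n. t ^ n *\<^sub>R c n) - c 0) \<le> 2 * K * a * t" if t: "0 < t" "t < r" for t
  proof -
    have ta: "0 < t * a" "t * a < 1/2"
      using t \<open>a > 0\<close> by (simp_all add: r_def field_simps)
    have le: "norm (t ^ n *\<^sub>R c n) \<le> K * (t * a) ^ n" for n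
      using mult_left_mono[OF bound, of "t ^ n" n] t by (simp add: power_mult_distrib mult_ac)
    have summ: "summable (\<lambda>n. K * (t * a) ^ n)"
      using ta by (intro summable_mult summable_geometric) simp
    have summ': "summable (\<lambda>n. t ^ n *\<^sub>R c n)"
      using summable_comparison_test'[OF summ le] .
    have "norm ((\<Sum>n. t ^ n *\<^sub>R c n) - c 0) = norm (\<Sum>n. t ^ Suc n *\<^sub>R c (Suc n))"
      using suminf_split_head[OF summ'] by simp
    also have "\<dots> \<le> (\<Sum>n. K * (t * a) ^ Suc n)"
      using le summable_Suc_iff[THEN iffD2, OF summ] by (intro norm_suminf_le)
    also have "\<dots> = K * (t * a) / (1 - t * a)"
      using suminf_mult[OF summable_geometric, of "t * a" "K * (t * a)"] suminf_geometric[of "t * a"] ta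
      by (simp add: mult_ac)
    also have "\<dots> \<le> K * (t * a) / (1 / 2)"
      using ta K by (intro divide_left_mono) auto
    finally show ?thesis by (simp add: mult_ac)
  qed
  then have "\<forall>\<^sub>F t in at_right 0. norm ((\<Sum>n. t ^ n *\<^sub>R c n) - c 0) \<le> 2 * K * a * t"
    using \<open>r > 0\<close> by (auto simp: eventually_at_right_field)
  moreover have "((\<lambda>t. 2 * K * a * t) \<longlongrightarrow> 0) (at_right 0)"
    by (auto intro!: tendsto_eq_intros)
  ultimately have "((\<lambda>t. (\<Sum>n. t ^ n *\<^sub>R c n) - c 0) \<longlongrightarrow> 0) (at_right 0)"
    by (rule Lim_null_comparison)
  then show ?thesis by (rule LIM_zero_cancel)
qed

text \<open>Coefficients are peeled off one at a time: the limit at 0 from the right is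
  \<open>c 0\<close>, and once this vanishes, division by t leaves the series of the shifted
  coefficients.\<close>

lemma powser_eq_0_imp:
  fixes c :: "nat \<Rightarrow> 'b::banach"
  assumes "\<And>n. norm (c n) \<le> K * a ^ n" "a > 0" "r > 0"
    and "\<And>t. 0 < t \<Longrightarrow> t < r \<Longrightarrow> (\<Sum>n. t ^ n *\<^sub>R c n) = 0"
  shows "c n = 0"
proof -
  have c0: "c 0 = 0" if "\<And>n. norm (c n) \<le> K * a ^ n" "r > 0"
    "\<And>t. 0 < t \<Longrightarrow> t < r \<Longrightarrow> (\<Sum>n. t ^ n *\<^sub>R c n) = 0" for c :: "nat \<Rightarrow> 'b" and K r
  proof -
    have "\<forall>\<^sub>F t in at_right 0. (\<Sum>n. t ^ n *\<^sub>R c n) = 0"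
      using that by (auto simp: eventually_at_right_field)
    then have "((\<lambda>t. \<Sum>n. t ^ n *\<^sub>R c n) \<longlongrightarrow> 0) (at_right 0)"
      by (simp add: tendsto_eventually)
    then show ?thesis
      using powser_tendsto_at_0[OF that(1) \<open>a > 0\<close>] tendsto_unique trivial_limit_at_right_real by blast
  qed
  show ?thesis
    using assms
  proof (induction n arbitrary: c K r)
    case (0 c K r)
    then show ?case using c0 by blast
  next
    case (Suc n c K r)
    show ?case
    proof (rule Suc.IH)
      show "norm (c (Suc n)) \<le> (K * a) * a ^ n" for n
        using Suc.prems(1)[of "Suc n"] by (simp add: mult_ac)
      \<comment> \<open>The minimum with 1/a keeps t where both series converge.\<close>
      show "min r (1 / a) > 0" "a > 0" using Suc.prems by auto
      fix t assume t: "0 < t" "t < min r (1 / a)"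
      have summ: "summable (\<lambda>n. t ^ n *\<^sub>R c n)"
        using summable_powser_scaleR[OF Suc.prems(1)] t Suc.prems(2) by (simp add: field_simps)
      have summ': "summable (\<lambda>n. t ^ n *\<^sub>R c (Suc n))"
        by (rule summable_powser_scaleR[where K = "K * a" and a = a])
           (use t Suc.prems(2) Suc.prems(1)[of "Suc _"] in \<open>simp_all add: field_simps\<close>)
      have "t *\<^sub>R (\<Sum>n. t ^ n *\<^sub>R c (Suc n)) = (\<Sum>n. t ^ Suc n *\<^sub>R c (Suc n))"
        using suminf_scaleR_right[OF summ', of t] by simp
      also have "\<dots> = 0"
        using suminf_split_head[OF summ] Suc.prems(4)[of t] t c0[OF Suc.prems(1,3,4)] by simp
      finally show "(\<Sum>n. t ^ n *\<^sub>R c (Suc n)) = 0" using t by simp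
    qed
  qed
qed

section \<open>Pseudo-resolvents\<close>

text \<open>The terms of the convergent binomial series at 1/2 are bounded, whence the base
  2.\<close>

lemma ces_exponential_bound:
  assumes "\<alpha> \<ge> 0"
  obtains K where "K > 0" "\<And>n. ces \<alpha> n \<le> K * 2 ^ n"
proof -
  have "summable (\<lambda>n. (1/2) ^ n * ces \<alpha> n)"
    using ces_sums_real[of \<alpha> "1/2"] assms by (auto simp: sums_iff)
  then have "Bseq (\<lambda>n. (1/2) ^ n * ces \<alpha> n)"
    by (intro convergent_imp_Bseq) (auto simp: convergent_def dest: summable_LIMSEQ_zero)
  then obtain K where "K > 0" "\<forall>n. norm ((1/2) ^ n * ces \<alpha> n) \<le> K"
    by (rule BseqE)
  then have "norm ((1/2) ^ n * ces \<alpha> n) \<le> K" for n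
    by blast
  then have "ces \<alpha> n \<le> K * 2 ^ n" for n
    using ces_nonneg[OF assms] by (simp add: power_one_over field_simps abs_of_nonneg)
  with \<open>K > 0\<close> show thesis using that by blast
qed

lemma powser_split_head:
  fixes c :: "nat \<Rightarrow> 'b::banach"
  assumes "\<And>n. norm (c n) \<le> K * a ^ n" "a > 0" "a * \<bar>t\<bar> < 1"
  shows "(\<Sum>n. t ^ n *\<^sub>R c n) = c 0 + t *\<^sub>R (\<Sum>n. t ^ n *\<^sub>R c (Suc n))"
proof -
  have summ: "summable (\<lambda>n. t ^ n *\<^sub>R c n)"
    by (rule summable_powser_scaleR[OF assms])
  have "norm (c (Suc n)) \<le> (K * a) * a ^ n" for n
    using assms(1)[of "Suc n"] by (simp add: mult_ac)
  then have "summable (\<lambda>n. t ^ n *\<^sub>R c (Suc n))"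
    using assms(2,3) by (rule summable_powser_scaleR)
  then show ?thesis
    using suminf_split_head[OF summ] suminf_scaleR_right[of "\<lambda>n. t ^ n *\<^sub>R c (Suc n)" t] by simp
qed

text \<open>As 1 - t > 0, the principal power is a real one, and the resolvent at 1/t becomes a real
  power series in t.\<close>

lemma cesaro_resolvent_of_real:
  fixes T :: "nat \<Rightarrow> ('a::complex_banach \<Rightarrow>\<^sub>L 'a)"
  assumes t: "0 < t" "t < 1" and summ: "summable (\<lambda>n. t ^ n *\<^sub>R T n)"
  shows "cesaro_resolvent \<alpha> T (of_real (1 / t)) x
    = (t * (1 - t) powr \<alpha>) *\<^sub>R (\<Sum>n. t ^ n *\<^sub>R T n) x"
proof -
  have "(1 - inverse (complex_of_real (1 / t))) powr of_real \<alpha> / of_real (1 / t)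
      = of_real (t * (1 - t) powr \<alpha>)"
    using t powr_of_real[of "1 - t" \<alpha>] by (simp add: field_simps)
  moreover have "(\<Sum>n. inverse (complex_of_real (1 / t)) ^ n *\<^sub>C T n x) = (\<Sum>n. t ^ n *\<^sub>R T n) x"
    using bounded_linear.suminf[OF blinfun.bounded_linear_left summ, of x]
    by (simp add: scaleC_blinfun_apply scaleR_scaleC)
  ultimately show ?thesis
    by (simp only: cesaro_resolvent_def scaleR_scaleC)
qed

text \<open>For real \<open>s\<close>, \<open>t\<close> the resolvent identity at \<open>1 / t\<close>, \<open>1 / s\<close> reads
  \<open>t \<kappa>(s) A(t) - s \<kappa>(t) A(s) = (t - s) A(t) A(s)\<close>, where \<open>A\<close> and \<open>\<kappa>\<close> are the generating functions
  of \<open>T\<close> and of the Cesaro numbers. Its first-order term at \<open>t = 0\<close> is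
  \<open>A(s) = \<kappa>(s) + s S A(s)\<close>, the generating function form of the recurrence.\<close>

lemma pseudo_resolvent_imp_cesaro_recurrence:
  fixes T :: "nat \<Rightarrow> ('a::complex_banach \<Rightarrow>\<^sub>L 'a)"
  assumes \<alpha>: "\<alpha> \<ge> 0" and a: "a > 1" and T0: "T 0 = id_blinfun"
    and bound: "\<And>n. norm (T n) \<le> C * a ^ n"
    and pseudo: "pseudo_resolvent {z. cmod z > a} (cesaro_resolvent \<alpha> T)"
  shows "cesaro_recurrence \<alpha> T"
proof -
  define S where "S = T 1 - \<alpha> *\<^sub>R id_blinfun"
  \<comment> \<open>This base exceeds both \<open>a\<close> and 2, so \<open>K * b ^ n\<close>
    dominates the operators and the kernel alike.\<close>
  define b where "b = a + 1"
  have b: "b > 2" "a < b" using a by (auto simp: b_def)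
  obtain K' where K': "K' > 0" "\<And>n. ces \<alpha> n \<le> K' * 2 ^ n"
    using ces_exponential_bound[OF \<alpha>] by blast
  have "C \<ge> 0" using order_trans[OF norm_ge_zero bound[of 0]] by simp
  define K where "K = C + K'"
  have K: "K > 0" "C \<le> K" "K' \<le> K" using K' \<open>C \<ge> 0\<close> by (auto simp: K_def)
  have T_le: "norm (T n) \<le> K * b ^ n" for n
    using bound[of n] mult_mono[of C K "a ^ n" "b ^ n"] power_mono[of a b n] K a b by simp
  have ces_le: "norm (ces \<alpha> n) \<le> K * b ^ n" for n
    using K'(2)[of n] mult_mono[of K' K "2 ^ n" "b ^ n"] power_mono[of 2 b n] K b
      ces_nonneg[OF \<alpha>, of n] by simp
  have T_le': "norm (T (Suc n)) \<le> (K * b) * b ^ n" for n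
    using T_le[of "Suc n"] by (simp add: mult_ac)
  have ces_le': "norm (ces \<alpha> (Suc n)) \<le> (K * b) * b ^ n" for n
    using ces_le[of "Suc n"] by (simp add: mult_ac)
  define A where "A t = (\<Sum>n. t ^ n *\<^sub>R T n)" for t
  define B where "B t = (\<Sum>n. t ^ n *\<^sub>R T (Suc n))" for t
  define \<kappa> where "\<kappa> t = (\<Sum>n. t ^ n *\<^sub>R ces \<alpha> n)" for t
  define l where "l t = (\<Sum>n. t ^ n *\<^sub>R ces \<alpha> (Suc n))" for t
  have range: "b * \<bar>t\<bar> < 1" "t < 1" "1 / t > a" if "0 < t" "t < 1 / b" for t
  proof -
    show bt: "b * \<bar>t\<bar> < 1" using that b by (simp add: field_simps)
    have "a * t < b * t" "1 * t < b * t" using that b a by (auto intro: mult_strict_right_mono)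
    moreover have "b * t < 1" using bt that by simp
    ultimately have "a * t < 1" "t < 1" by linarith+
    with that show "t < 1" "1 / t > a" by (simp_all add: field_simps)
  qed
  have b0: "b > 0" using b by simp
  have A: "A t = id_blinfun + t *\<^sub>R B t" and \<kappa>: "\<kappa> t = 1 + t * l t" if "0 < t" "t < 1 / b" for t
    using powser_split_head[OF T_le b0 range(1)[OF that]]
      powser_split_head[OF ces_le b0 range(1)[OF that]]
    by (simp_all add: A_def B_def \<kappa>_def l_def T0 \<alpha>)
  have \<kappa>_powr: "\<kappa> t = (1 - t) powr (- \<alpha>)" if "0 < t" "t < 1 / b" for t
    using ces_sums_real[OF \<alpha>, of t] range[OF that] that by (simp add: \<kappa>_def sums_iff)
  have summA: "summable (\<lambda>n. t ^ n *\<^sub>R T n)" if "0 < t" "t < 1 / b" for t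
    by (rule summable_powser_scaleR[OF T_le b0 range(1)[OF that]])
  have identity: "(t * \<kappa> s) *\<^sub>R A t - (s * \<kappa> t) *\<^sub>R A s = (t - s) *\<^sub>R (A t o\<^sub>L A s)"
    if t: "0 < t" "t < 1 / b" and s: "0 < s" "s < 1 / b" for t s
  proof (rule blinfun_eqI)
    fix x
    define g where "g u = (1 - u) powr \<alpha>" for u :: real
    have R: "cesaro_resolvent \<alpha> T (of_real (1 / u)) y = (u * g u) *\<^sub>R A u y"
      if "0 < u" "u < 1 / b" for u y
      using cesaro_resolvent_of_real[OF that(1) range(2)[OF that] summA[OF that]]
      by (simp add: A_def g_def)
    have g\<kappa>: "g u * \<kappa> u = 1" if "0 < u" "u < 1 / b" for u
      using range[OF that] that by (simp add: g_def \<kappa>_powr powr_minus)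
    have "of_real (1 / u) \<in> {z. cmod z > a}" if "0 < u" "u < 1 / b" for u
      using range(3)[OF that] that by (simp add: norm_divide)
    then have "(t * g t) *\<^sub>R A t x - (s * g s) *\<^sub>R A s x
        = (of_real (1 / s) - of_real (1 / t)) *\<^sub>C (t * g t) *\<^sub>R A t ((s * g s) *\<^sub>R A s x)"
      using pseudo t s unfolding pseudo_resolvent_def R[OF t, symmetric] R[OF s, symmetric] by blast
    also have "\<dots> = ((1 / s - 1 / t) * (t * g t) * (s * g s)) *\<^sub>R A t (A s x)"
      by (simp only: of_real_diff[symmetric] scaleR_scaleC[symmetric] blinfun.scaleR_right
          scaleR_scaleR mult.assoc)
    also have "(1 / s - 1 / t) * (t * g t) * (s * g s) = (t - s) * g t * g s"
      using t s by (simp add: field_simps)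
    \<comment> \<open>Multiplication by \<kappa>(t) \<kappa>(s) removes the powers \<open>g\<close>,
      since \<open>g u * \<kappa> u\<close> is 1.\<close>
    finally have "(\<kappa> t * \<kappa> s) *\<^sub>R ((t * g t) *\<^sub>R A t x - (s * g s) *\<^sub>R A s x)
        = (\<kappa> t * \<kappa> s) *\<^sub>R ((t - s) * g t * g s) *\<^sub>R A t (A s x)"
      by simp
    moreover have "\<kappa> t * \<kappa> s * (t * g t) = t * \<kappa> s" "\<kappa> t * \<kappa> s * (s * g s) = s * \<kappa> t"
        "\<kappa> t * \<kappa> s * ((t - s) * g t * g s) = t - s"
      using g\<kappa>[OF t] g\<kappa>[OF s] by algebra+
    ultimately show "((t * \<kappa> s) *\<^sub>R A t - (s * \<kappa> t) *\<^sub>R A s) x = ((t - s) *\<^sub>R (A t o\<^sub>L A s)) x"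
      by (simp add: scaleR_diff_right blinfun.diff_left blinfun.scaleR_left)
  qed
  have gen: "A s = \<kappa> s *\<^sub>R id_blinfun + s *\<^sub>R (S o\<^sub>L A s)" if s: "0 < s" "s < 1 / b" for s
  proof -
    \<comment> \<open>The difference of the two sides of \<open>identity\<close>, divided by t:
      inserting A = I + t B and \<kappa> = 1 + t l cancels the terms of order zero, and what remains
      has a limit at t = 0.\<close>
    define E where "E t = \<kappa> s *\<^sub>R A t - (s * l t) *\<^sub>R A s - A s - (t - s) *\<^sub>R (B t o\<^sub>L A s)" for t
    have E0: "E t = 0" if t: "0 < t" "t < 1 / b" for t
    proof -
      have "t *\<^sub>R E t = ((t * \<kappa> s) *\<^sub>R A t - (s * \<kappa> t) *\<^sub>R A s)
          - ((t - s) *\<^sub>R A s + (t - s) *\<^sub>R t *\<^sub>R (B t o\<^sub>L A s))"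
        by (simp add: E_def \<kappa>[OF t] algebra_simps)
      also have "\<dots> = (t - s) *\<^sub>R (A t o\<^sub>L A s) - (t - s) *\<^sub>R (A s + t *\<^sub>R (B t o\<^sub>L A s))"
        by (simp only: identity[OF t s] scaleR_add_right)
      also have "A s + t *\<^sub>R (B t o\<^sub>L A s) = A t o\<^sub>L A s"
        by (simp add: A[OF t] blinfun_compose.add_left blinfun_compose.scaleR_left)
      finally have "t *\<^sub>R E t = 0" by simp
      then show ?thesis using t by simp
    qed
    have "((\<lambda>t. E t) \<longlongrightarrow> \<kappa> s *\<^sub>R T 0 - (s * ces \<alpha> (Suc 0)) *\<^sub>R A s - A s - (0 - s) *\<^sub>R (T (Suc 0) o\<^sub>L A s))
        (at_right 0)"
      unfolding E_def A_def[of t for t] B_def l_def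
      by (intro tendsto_intros blinfun_compose.tendsto powser_tendsto_at_0[OF T_le b0]
          powser_tendsto_at_0[where c = "\<lambda>n. T (Suc n)", OF T_le' b0]
          powser_tendsto_at_0[where c = "\<lambda>n. ces \<alpha> (Suc n)", OF ces_le' b0])
    moreover have "((\<lambda>t. E t) \<longlongrightarrow> 0) (at_right 0)"
      using E0 b by (intro tendsto_eventually) (auto simp: eventually_at_right_field intro!: exI[of _ "1/b"])
    \<comment> \<open>The limit picks out the coefficients T 0 = I, k 1 = \<alpha> and T 1, which
      combine to S = T 1 - \<alpha> I.\<close>
    ultimately have "\<kappa> s *\<^sub>R T 0 - (s * \<alpha>) *\<^sub>R A s - A s + s *\<^sub>R (T 1 o\<^sub>L A s) = 0"
      using tendsto_unique[OF trivial_limit_at_right_real] \<alpha> by fastforce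
    then show ?thesis
      by (simp add: S_def T0 blinfun_compose.diff_left blinfun_compose.scaleR_left algebra_simps)
  qed
  \<comment> \<open>Comparison of coefficients in \<open>gen\<close>: the defects of the recurrence
    have a generating function that vanishes for small t > 0.\<close>
  have "T (Suc n) - (S o\<^sub>L T n) - ces \<alpha> (Suc n) *\<^sub>R id_blinfun = 0" for n
  proof (rule powser_eq_0_imp[where c = "\<lambda>n. T (Suc n) - (S o\<^sub>L T n) - ces \<alpha> (Suc n) *\<^sub>R id_blinfun"
        and a = b and r = "1 / b"])
    fix n
    have "norm (T (Suc n) - (S o\<^sub>L T n) - ces \<alpha> (Suc n) *\<^sub>R id_blinfun)
        \<le> norm (T (Suc n)) + norm (S o\<^sub>L T n) + norm (ces \<alpha> (Suc n) *\<^sub>R (id_blinfun :: 'a \<Rightarrow>\<^sub>L 'a))"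
      by (intro order_trans[OF norm_triangle_ineq4] add_right_mono norm_triangle_ineq4)
    also have "\<dots> \<le> (K * b) * b ^ n + norm S * (K * b ^ n) + ((K * b) * b ^ n) * 1"
    proof (intro add_mono T_le')
      show "norm (S o\<^sub>L T n) \<le> norm S * (K * b ^ n)"
        by (rule order_trans[OF norm_blinfun_compose mult_left_mono[OF T_le norm_ge_zero]])
      show "norm (ces \<alpha> (Suc n) *\<^sub>R (id_blinfun :: 'a \<Rightarrow>\<^sub>L 'a)) \<le> ((K * b) * b ^ n) * 1"
        unfolding norm_scaleR using ces_le'[of n] norm_blinfun_id_le K b0
        by (intro mult_mono) auto
    qed
    finally show "norm (T (Suc n) - (S o\<^sub>L T n) - ces \<alpha> (Suc n) *\<^sub>R id_blinfun)
        \<le> (K * b + norm S * K + K * b) * b ^ n"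
      by (simp add: algebra_simps)
  next
    show "b > 0" "1 / b > 0" using b by auto
    fix t assume t: "0 < t" "t < 1 / b"
    have "(\<lambda>n. S o\<^sub>L (t ^ n *\<^sub>R T n)) sums (S o\<^sub>L A t)"
      unfolding A_def
      by (intro bounded_linear.sums[OF blinfun_compose.bounded_linear_right] summable_sums summA t)
    then have "(\<lambda>n. t ^ n *\<^sub>R (S o\<^sub>L T n)) sums (S o\<^sub>L A t)"
      by (simp add: blinfun_compose.scaleR_right)
    moreover have "(\<lambda>n. t ^ n *\<^sub>R T (Suc n)) sums B t"
      unfolding B_def by (intro summable_sums summable_powser_scaleR[OF T_le' b0] range(1) t)
    moreover have "(\<lambda>n. (t ^ n *\<^sub>R ces \<alpha> (Suc n)) *\<^sub>R id_blinfun) sums (l t *\<^sub>R (id_blinfun :: 'a \<Rightarrow>\<^sub>L 'a))"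
      unfolding l_def
      by (intro bounded_linear.sums[OF bounded_linear_scaleR_left] summable_sums
          summable_powser_scaleR[OF ces_le' b0] range(1) t)
    ultimately have "(\<lambda>n. t ^ n *\<^sub>R T (Suc n) - t ^ n *\<^sub>R (S o\<^sub>L T n) - (t ^ n *\<^sub>R ces \<alpha> (Suc n)) *\<^sub>R id_blinfun)
        sums (B t - (S o\<^sub>L A t) - l t *\<^sub>R id_blinfun)"
      by (intro sums_diff)
    moreover have "t *\<^sub>R (B t - (S o\<^sub>L A t) - l t *\<^sub>R id_blinfun) = 0"
      using gen[OF t] A[OF t] \<kappa>[OF t] by (simp add: algebra_simps)
    then have "B t - (S o\<^sub>L A t) - l t *\<^sub>R id_blinfun = 0"
      unfolding scaleR_eq_0_iff using t by blast
    ultimately show "(\<Sum>n. t ^ n *\<^sub>R (T (Suc n) - (S o\<^sub>L T n) - ces \<alpha> (Suc n) *\<^sub>R id_blinfun)) = 0"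
      using t by (simp add: sums_iff scaleR_diff_right)
  qed
  then show ?thesis
    unfolding cesaro_recurrence_def S_def[symmetric] by (simp add: algebra_simps)
qed

text \<open>Evaluate R S Q x in two ways, with \<open>R\<close> as left inverse at \<open>z\<close>
  and \<open>Q\<close> as right inverse at \<open>w\<close>; the two values differ by the resolvent
  identity.\<close>

lemma cesaro_recurrence_imp_pseudo_resolvent:
  fixes T :: "nat \<Rightarrow> ('a::complex_banach \<Rightarrow>\<^sub>L 'a)"
  assumes "\<alpha> \<ge> 0" "a > 1" "\<And>n. T n \<in> bounded_ops" "T 0 = id_blinfun"
    "\<And>n. norm (T n) \<le> K * a ^ n" "cesaro_recurrence \<alpha> T"
  shows "pseudo_resolvent {z. cmod z > a} (cesaro_resolvent \<alpha> T)"
  unfolding pseudo_resolvent_def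
proof (intro conjI ballI allI)
  fix z assume z: "z \<in> {z. cmod z > a}"
  obtain R where R: "R \<in> bounded_ops" "cesaro_resolvent \<alpha> T z = blinfun_apply R"
    and RS: "\<And>x. R ((T 1 - \<alpha> *\<^sub>R id_blinfun) x) = z *\<^sub>C R x - x"
    using cesaro_resolvent_inverse[OF assms] z by blast
  then show "\<exists>S\<in>bounded_ops. cesaro_resolvent \<alpha> T z = blinfun_apply S" by blast
  fix w x assume w: "w \<in> {z. cmod z > a}"
  obtain Q where Q: "Q \<in> bounded_ops" "cesaro_resolvent \<alpha> T w = blinfun_apply Q"
    and SQ: "\<And>x. (T 1 - \<alpha> *\<^sub>R id_blinfun) (Q x) = w *\<^sub>C Q x - x"
    using cesaro_resolvent_inverse[OF assms] w by blast
  have "R (w *\<^sub>C Q x - x) = z *\<^sub>C R (Q x) - Q x"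
    using RS[of "Q x"] by (simp only: SQ)
  moreover have "R (w *\<^sub>C Q x) = w *\<^sub>C R (Q x)"
    using R(1) by (simp add: bounded_ops_def)
  ultimately show "cesaro_resolvent \<alpha> T z x - cesaro_resolvent \<alpha> T w x
      = (w - z) *\<^sub>C cesaro_resolvent \<alpha> T z (cesaro_resolvent \<alpha> T w x)"
    by (simp add: R Q blinfun.diff_right scaleC.diff_left algebra_simps)
qed

section \<open>Weyl differences and convolution\<close>

lemma c00_iff: "f \<in> c00 \<longleftrightarrow> (\<exists>N. \<forall>n\<ge>N. f n = 0)"
  by (auto simp: c00_def finite_nat_set_iff_bounded not_le[symmetric])

lemma c00_zero: "(\<lambda>_. 0) \<in> c00"
  by (simp add: c00_def)

lemma c00_add: "f \<in> c00 \<Longrightarrow> g \<in> c00 \<Longrightarrow> (\<lambda>j. f j + g j) \<in> c00"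
  unfolding c00_iff by (metis add.right_neutral le_max_iff_disj max.cobounded1 order_trans max.cobounded2)

lemma c00_scale: "f \<in> c00 \<Longrightarrow> (\<lambda>j. c * f j) \<in> c00"
  unfolding c00_iff by auto

lemma c00_diff: "f \<in> c00 \<Longrightarrow> g \<in> c00 \<Longrightarrow> (\<lambda>j. f j - g j) \<in> c00"
  using c00_add[of f "\<lambda>j. -1 * g j"] c00_scale[of g "-1"] by simp

lemma c00_sum: "(\<And>i. i \<in> I \<Longrightarrow> f i \<in> c00) \<Longrightarrow> (\<lambda>j. \<Sum>i\<in>I. c i * f i j) \<in> c00"
  by (induction I rule: infinite_finite_induct) (auto intro!: c00_zero c00_add c00_scale)

lemma c00_hseq: "hseq \<alpha> n \<in> c00"
  unfolding c00_iff by (rule exI[of _ "Suc n"]) (simp add: hseq_def)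

lemma c00_unit_seq: "unit_seq n \<in> c00"
  unfolding c00_iff by (rule exI[of _ "Suc n"]) (simp add: unit_seq_def)

lemma c00_conv:
  assumes "f \<in> c00" "g \<in> c00"
  shows "conv f g \<in> c00"
proof -
  obtain M N where M: "\<And>n. n \<ge> M \<Longrightarrow> f n = 0" and N: "\<And>n. n \<ge> N \<Longrightarrow> g n = 0"
    using assms by (auto simp: c00_iff)
  have "f (n - j) * g j = 0" if "n \<ge> M + N" for n j
    using M[of "n - j"] N[of j] that by (cases "j \<ge> N") auto
  then show ?thesis
    unfolding c00_iff conv_def by (intro exI[of _ "M + N"]) (simp add: sum.neutral)
qed

lemma conv_commute: "conv f g = conv g f"
proof
  fix n
  show "conv f g n = conv g f n"
    unfolding conv_def
    by (rule sum.reindex_bij_witness[where i = "\<lambda>j. n - j" and j = "\<lambda>j. n - j"]) auto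
qed

lemma conv_sum_left: "conv (\<lambda>j. \<Sum>i\<in>I. c i * f i j) g = (\<lambda>j. \<Sum>i\<in>I. c i * conv (f i) g j)"
  unfolding conv_def
  by (rule ext) (simp add: sum_distrib_left sum_distrib_right mult.assoc sum.swap[of _ I])

lemma conv_sum_right: "conv f (\<lambda>j. \<Sum>i\<in>I. c i * g i j) = (\<lambda>j. \<Sum>i\<in>I. c i * conv f (g i) j)"
  using conv_sum_left[where I = I and c = c and f = g and g = f] by (simp add: conv_commute[of f])

text \<open>The usual splitting of a difference of products, from which convolution is Lipschitz on
  bounded sets.\<close>

lemma conv_diff: "(\<lambda>j. conv f g j - conv f' g' j)
    = (\<lambda>j. conv (\<lambda>i. f i - f' i) g j + conv f' (\<lambda>i. g i - g' i) j)"
  by (rule ext) (simp add: conv_def sum_subtractf[symmetric] sum.distrib[symmetric] algebra_simps)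

lemma hseq_0: "\<alpha> \<ge> 0 \<Longrightarrow> hseq \<alpha> 0 = unit_seq 0"
  by (rule ext) (simp add: hseq_def unit_seq_def)

lemma hseq_zero: "hseq 0 n = unit_seq n"
  by (rule ext) (auto simp: hseq_def unit_seq_def ces_def)

lemma hseq_Suc_0: "\<alpha> \<ge> 0 \<Longrightarrow> hseq \<alpha> (Suc 0) = (\<lambda>j. unit_seq (Suc 0) j + of_real \<alpha> * unit_seq 0 j)"
  by (rule ext) (auto simp: hseq_def unit_seq_def le_Suc_eq)

lemma conv_unit_seq_0: "conv (unit_seq 0) f = f"
proof
  fix n
  have "conv (unit_seq 0) f n = (\<Sum>j=0..n. if j = n then f j else 0)"
    unfolding conv_def by (intro sum.cong refl) (auto simp: unit_seq_def)
  then show "conv (unit_seq 0) f n = f n" by simp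
qed

text \<open>The sequence of index n + 1 is the right shift of the one of index n, plus k (n + 1)
  times the one of index 0. So \<open>hseq\<close> obeys the recurrence with the shift in place of
  S, and the induction for \<open>T\<close> repeats.\<close>

lemma conv_hseq:
  assumes \<alpha>: "\<alpha> \<ge> 0"
  shows "conv (hseq \<alpha> n) (hseq \<alpha> m) j = cesaro_product_rhs (ces \<alpha>) (\<lambda>u. hseq \<alpha> u j) n m"
proof (induction n arbitrary: j)
  case 0
  show ?case by (simp add: \<alpha> cesaro_product_rhs_0 hseq_0 conv_unit_seq_0)
next
  case (Suc n)
  define h' where "h' u i = (case i of 0 \<Rightarrow> 0 | Suc i' \<Rightarrow> hseq \<alpha> u i')" for u i
  have h': "h' u i = hseq \<alpha> (Suc u) i - ces \<alpha> (Suc u) *\<^sub>R hseq \<alpha> 0 i" for u i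
    by (auto simp: h'_def hseq_def \<alpha> scaleR_conv_of_real split: nat.split)
  have "conv (hseq \<alpha> (Suc n)) (hseq \<alpha> m) j
      = conv (h' n) (hseq \<alpha> m) j + ces \<alpha> (Suc n) *\<^sub>R conv (hseq \<alpha> 0) (hseq \<alpha> m) j"
    unfolding conv_def scaleR_sum_right
    by (subst sum.distrib[symmetric]) (intro sum.cong refl, simp add: h' algebra_simps)
  also have "conv (hseq \<alpha> 0) (hseq \<alpha> m) j = hseq \<alpha> m j"
    by (simp add: hseq_0[OF \<alpha>] conv_unit_seq_0)
  also have "conv (h' n) (hseq \<alpha> m) j = cesaro_product_rhs (ces \<alpha>) (\<lambda>u. h' u j) n m"
  proof (cases j)
    case 0
    then show ?thesis by (simp add: conv_def h'_def cesaro_product_rhs_def)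
  next
    case (Suc i)
    \<comment> \<open>Shifting a factor shifts the product, so the induction hypothesis is used at
      the previous index.\<close>
    have "conv (h' n) (hseq \<alpha> m) j = conv (hseq \<alpha> n) (hseq \<alpha> m) i"
      unfolding Suc conv_def
      by (simp add: h'_def) (intro sum.cong refl, simp add: Suc_diff_le)
    then show ?thesis by (simp add: Suc.IH Suc h'_def)
  qed
  also have "\<dots> + ces \<alpha> (Suc n) *\<^sub>R hseq \<alpha> m j = cesaro_product_rhs (ces \<alpha>) (\<lambda>u. hseq \<alpha> u j) (Suc n) m"
    by (rule cesaro_product_rhs_shift[symmetric]) (simp_all add: \<alpha> h')
  finally show ?case .
qed

section \<open>Weyl sums and differences of finitely supported sequences\<close>

lemma weyl_sum_eq:
  assumes "\<And>j. j \<ge> N \<Longrightarrow> f j = 0"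
  shows "weyl_sum \<beta> f n = (\<Sum>j=n..<N. of_real (ces \<beta> (j - n)) * f j)"
proof -
  have "weyl_sum \<beta> f n = (\<Sum>\<^sub>\<infinity>j\<in>{n..<N}. of_real (ces \<beta> (j - n)) * f j)"
    unfolding weyl_sum_def by (rule infsum_cong_neutral) (use assms in auto)
  then show ?thesis by simp
qed

lemma weyl_sum_add:
  assumes "f \<in> c00" "g \<in> c00"
  shows "weyl_sum \<beta> (\<lambda>j. f j + g j) = (\<lambda>n. weyl_sum \<beta> f n + weyl_sum \<beta> g n)"
proof
  fix n
  obtain M N where "\<And>n. n \<ge> M \<Longrightarrow> f n = 0" "\<And>n. n \<ge> N \<Longrightarrow> g n = 0"
    using assms by (auto simp: c00_iff)
  then have "f j = 0" "g j = 0" if "j \<ge> M + N" for j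
    using that by auto
  then show "weyl_sum \<beta> (\<lambda>j. f j + g j) n = weyl_sum \<beta> f n + weyl_sum \<beta> g n"
    by (simp add: weyl_sum_eq[of "M + N"] sum.distrib distrib_left)
qed

lemma weyl_sum_scale: "weyl_sum \<beta> (\<lambda>j. c * f j) = (\<lambda>n. c * weyl_sum \<beta> f n)"
  by (rule ext) (simp add: weyl_sum_def mult.left_commute[of _ c] infsum_cmult_right')

lemma fdiff_funpow_add: "(fdiff ^^ m) (\<lambda>j. f j + g j) = (\<lambda>n. (fdiff ^^ m) f n + (fdiff ^^ m) g n)"
  by (induction m) (auto simp: fdiff_def)

lemma fdiff_funpow_scale: "(fdiff ^^ m) (\<lambda>j. c * f j) = (\<lambda>n. c * (fdiff ^^ m) f n)"
  by (induction m) (auto simp: fdiff_def algebra_simps)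

lemma weyl_diff_add:
  "f \<in> c00 \<Longrightarrow> g \<in> c00 \<Longrightarrow> weyl_diff \<alpha> (\<lambda>j. f j + g j) n = weyl_diff \<alpha> f n + weyl_diff \<alpha> g n"
  by (simp add: weyl_diff_def weyl_sum_add fdiff_funpow_add Let_def distrib_left)

lemma weyl_diff_scale: "weyl_diff \<alpha> (\<lambda>j. c * f j) n = c * weyl_diff \<alpha> f n"
  by (simp add: weyl_diff_def weyl_sum_scale fdiff_funpow_scale Let_def)

lemma weyl_diff_sum:
  "(\<And>i. i \<in> I \<Longrightarrow> f i \<in> c00) \<Longrightarrow>
    weyl_diff \<alpha> (\<lambda>j. \<Sum>i\<in>I. c i * f i j) n = (\<Sum>i\<in>I. c i * weyl_diff \<alpha> (f i) n)"
proof (induction I rule: infinite_finite_induct)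
  case (insert x I)
  then show ?case
    by (simp add: weyl_diff_add weyl_diff_scale c00_sum c00_scale)
qed (use weyl_diff_scale[of \<alpha> 0 "\<lambda>_. 0" n] in simp_all)

text \<open>With l = j - i the Weyl sum is the convolution of the kernels of orders \<beta> and
  \<alpha> at n - i, so the orders add.\<close>

lemma weyl_sum_hseq:
  assumes "\<alpha> \<ge> 0" "\<beta> \<ge> 0"
  shows "weyl_sum \<beta> (hseq \<alpha> n) = hseq (\<alpha> + \<beta>) n"
proof
  fix i
  have "weyl_sum \<beta> (hseq \<alpha> n) i = (\<Sum>j=i..<Suc n. of_real (ces \<beta> (j - i)) * hseq \<alpha> n j)"
    by (rule weyl_sum_eq) (simp add: hseq_def)
  also have "\<dots> = hseq (\<alpha> + \<beta>) n i"
  proof (cases "i \<le> n")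
    case True
    have "(\<Sum>j=i..<Suc n. of_real (ces \<beta> (j - i)) * hseq \<alpha> n j)
        = (\<Sum>l=0..n-i. of_real (ces \<beta> l * ces \<alpha> (n - i - l)))"
      by (rule sum.reindex_bij_witness[where i = "\<lambda>l. l + i" and j = "\<lambda>j. j - i"])
         (use True in \<open>auto simp: hseq_def\<close>)
    then show ?thesis
      using True ces_Vandermonde[of \<beta> \<alpha> "n - i"] assms
      by (simp add: hseq_def add.commute flip: of_real_sum of_real_mult)
  qed (simp add: hseq_def)
  finally show "weyl_sum \<beta> (hseq \<alpha> n) i = hseq (\<alpha> + \<beta>) n i" .
qed

lemma fdiff_hseq:
  assumes "\<alpha> \<ge> 0"
  shows "fdiff (hseq (\<alpha> + 1) n) i = - hseq \<alpha> n i"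
proof -
  consider "i < n" | "i = n" | "i > n" by linarith
  then show ?thesis
  proof cases
    case 1
    then have "n - i = Suc (n - Suc i)" by simp
    then show ?thesis
      using 1 ces_diff[OF assms, of "n - Suc i"]
      by (simp add: fdiff_def hseq_def flip: of_real_diff of_real_minus)
  qed (use assms in \<open>simp_all add: fdiff_def hseq_def\<close>)
qed

lemma fdiff_funpow_hseq:
  "\<alpha> \<ge> 0 \<Longrightarrow> (fdiff ^^ m) (hseq (\<alpha> + of_nat m) n) = (\<lambda>i. (-1) ^ m * hseq \<alpha> n i)"
proof (induction m arbitrary: \<alpha>)
  case (Suc m)
  have "(fdiff ^^ Suc m) (hseq (\<alpha> + of_nat (Suc m)) n)
      = fdiff (\<lambda>i. (-1) ^ m * hseq (\<alpha> + 1) n i)"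
    using Suc.IH[of "\<alpha> + 1"] Suc.prems by (simp add: add_ac)
  also have "\<dots> = (\<lambda>i. (-1) ^ m * fdiff (hseq (\<alpha> + 1) n) i)"
    by (rule ext) (simp add: fdiff_def algebra_simps)
  finally show ?case
    by (simp add: fdiff_hseq[OF Suc.prems])
qed simp

text \<open>The Weyl sum of order m - \<alpha> raises the order to m, and m differences lower it to
  0, where \<open>hseq\<close> is the unit sequence. The two signs \<open>(-1) ^ m\<close>
  cancel.\<close>

lemma weyl_diff_hseq:
  assumes "\<alpha> \<ge> 0"
  shows "weyl_diff \<alpha> (hseq \<alpha> n) = unit_seq n"
proof (cases "\<alpha> = 0")
  case True
  then show ?thesis by (simp add: weyl_diff_def hseq_zero fun_eq_iff)
next
  case False
  define m where "m = nat \<lfloor>\<alpha>\<rfloor> + 1"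
  have "real m - \<alpha> \<ge> 0"
    using assms by (simp add: m_def) linarith
  then have "weyl_sum (real m - \<alpha>) (hseq \<alpha> n) = hseq (0 + of_nat m) n"
    using weyl_sum_hseq[OF assms] by simp
  then have "weyl_diff \<alpha> (hseq \<alpha> n) i = (-1) ^ m * ((-1) ^ m * hseq 0 n i)" for i
    using False fdiff_funpow_hseq[of 0 m n]
    by (simp only: weyl_diff_def m_def[symmetric] Let_def if_False order_refl)
  then show ?thesis
    by (simp add: hseq_zero fun_eq_iff flip: power_mult_distrib mult.assoc)
qed

text \<open>The family is unitriangular: \<open>hseq \<alpha> N\<close> has entry 1 at N and
  vanishes beyond, so subtracting \<open>f N\<close> times it shortens the support.\<close>

lemma hseq_combination_exists:
  assumes "\<alpha> \<ge> 0"
  shows "(\<And>j. j \<ge> N \<Longrightarrow> f j = 0) \<Longrightarrow> \<exists>c. f = (\<lambda>j. \<Sum>n<N. c n * hseq \<alpha> n j)"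
proof (induction N arbitrary: f)
  case 0
  then show ?case by auto
next
  case (Suc N)
  have "\<exists>c. (\<lambda>j. f j - f N * hseq \<alpha> N j) = (\<lambda>j. \<Sum>n<N. c n * hseq \<alpha> n j)"
  proof (rule Suc.IH)
    fix j assume "j \<ge> N"
    then show "f j - f N * hseq \<alpha> N j = 0"
      using Suc.prems[of j] assms by (cases "j = N") (simp_all add: hseq_def)
  qed
  then obtain c where c: "f j - f N * hseq \<alpha> N j = (\<Sum>n<N. c n * hseq \<alpha> n j)" for j
    by (metis (no_types))
  have "f = (\<lambda>j. \<Sum>n<Suc N. (c(N := f N)) n * hseq \<alpha> n j)"
  proof
    fix j
    have "(\<Sum>n<N. (c(N := f N)) n * hseq \<alpha> n j) = (\<Sum>n<N. c n * hseq \<alpha> n j)"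
      by (intro sum.cong) auto
    then show "f j = (\<Sum>n<Suc N. (c(N := f N)) n * hseq \<alpha> n j)"
      using c[of j] by (simp add: algebra_simps)
  qed
  then show ?case by blast
qed

text \<open>The Weyl difference sends \<open>hseq \<alpha> n\<close> to the n-th unit sequence, so
  applied to any such combination it reads off the coefficients.\<close>

lemma weyl_diff_expansion:
  assumes \<alpha>: "\<alpha> \<ge> 0" and N: "\<And>j. j \<ge> N \<Longrightarrow> f j = 0"
  shows "f = (\<lambda>j. \<Sum>n<N. weyl_diff \<alpha> f n * hseq \<alpha> n j)" "\<And>n. n \<ge> N \<Longrightarrow> weyl_diff \<alpha> f n = 0"
proof -
  obtain c where c: "f = (\<lambda>j. \<Sum>n<N. c n * hseq \<alpha> n j)"
    using hseq_combination_exists[OF \<alpha>, of N f] N by blast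
  have "weyl_diff \<alpha> f n = (\<Sum>i<N. c i * unit_seq i n)" for n
    by (subst c) (simp add: weyl_diff_sum c00_hseq weyl_diff_hseq[OF \<alpha>])
  also have "(\<Sum>i<N. c i * unit_seq i n) = (\<Sum>i<N. if i = n then c i else 0)" for n
    by (intro sum.cong) (auto simp: unit_seq_def)
  finally have W: "weyl_diff \<alpha> f n = (if n < N then c n else 0)" for n
    by simp
  then show "weyl_diff \<alpha> f n = 0" if "n \<ge> N" for n using that by simp
  show "f = (\<lambda>j. \<Sum>n<N. weyl_diff \<alpha> f n * hseq \<alpha> n j)"
    by (subst c) (simp add: W)
qed

lemma weyl_diff_in_c00: "\<alpha> \<ge> 0 \<Longrightarrow> f \<in> c00 \<Longrightarrow> weyl_diff \<alpha> f \<in> c00"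
  using weyl_diff_expansion(2) unfolding c00_iff by metis

section \<open>The weighted norm and continuity of convolution\<close>

locale cesaro_weight =
  fixes \<alpha> :: real and \<phi> :: "nat \<Rightarrow> real"
  assumes \<alpha>: "\<alpha> \<ge> 0" and \<phi>: "\<phi> \<in> omega \<alpha>"
begin

abbreviation "q \<equiv> qnorm \<alpha> \<phi>"
abbreviation "W \<equiv> weyl_diff \<alpha>"
abbreviation "h \<equiv> hseq \<alpha>"

lemma \<phi>_pos: "\<phi> n > 0"
  using \<phi> by (simp add: omega_def omega_loc_def)

lemma expansion:
  assumes "f \<in> c00"
  obtains N where "f = (\<lambda>j. \<Sum>n<N. W f n * h n j)" "\<And>n. n \<ge> N \<Longrightarrow> W f n = 0"
  using assms weyl_diff_expansion[OF \<alpha>] unfolding c00_iff by metis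

lemma qnorm_eq: "(\<And>n. n \<ge> N \<Longrightarrow> W f n = 0) \<Longrightarrow> q f = (\<Sum>n<N. \<phi> n * cmod (W f n))"
  unfolding qnorm_def by (rule suminf_finite) (auto simp: not_less[symmetric])

lemma summable_qnorm:
  assumes "f \<in> c00"
  shows "summable (\<lambda>n. \<phi> n * cmod (W f n))"
proof (rule summable_finite)
  show "finite {n. W f n \<noteq> 0}"
    using weyl_diff_in_c00[OF \<alpha> assms] by (simp add: c00_def)
qed auto

lemma qnorm_nonneg: "f \<in> c00 \<Longrightarrow> q f \<ge> 0"
  unfolding qnorm_def by (intro suminf_nonneg summable_qnorm) (simp_all add: \<phi>_pos less_imp_le)

lemma qnorm_zero: "q (\<lambda>_. 0) = 0"
  using weyl_diff_scale[of \<alpha> 0 "\<lambda>_. 0"] by (simp add: qnorm_def)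

lemma qnorm_scale: "f \<in> c00 \<Longrightarrow> q (\<lambda>j. c * f j) = cmod c * q f"
  unfolding qnorm_def weyl_diff_scale norm_mult mult.left_commute[of "\<phi> _"]
  by (rule suminf_mult[OF summable_qnorm])

lemma qnorm_add:
  assumes "f \<in> c00" "g \<in> c00"
  shows "q (\<lambda>j. f j + g j) \<le> q f + q g"
proof -
  have "q (\<lambda>j. f j + g j) \<le> (\<Sum>n. \<phi> n * cmod (W f n) + \<phi> n * cmod (W g n))"
    unfolding qnorm_def using assms \<phi>_pos
    by (intro suminf_le summable_qnorm c00_add summable_add)
       (simp_all add: weyl_diff_add norm_triangle_ineq less_imp_le flip: distrib_left)
  then show ?thesis
    using assms by (simp add: qnorm_def suminf_add summable_qnorm)
qed

lemma qnorm_diff: "f \<in> c00 \<Longrightarrow> g \<in> c00 \<Longrightarrow> q (\<lambda>j. f j - g j) \<le> q f + q g"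
  using qnorm_add[of f "\<lambda>j. -1 * g j"] qnorm_scale[of g "-1"] c00_scale[of g "-1"] by simp

lemma qnorm_diff_commute: "f \<in> c00 \<Longrightarrow> g \<in> c00 \<Longrightarrow> q (\<lambda>j. f j - g j) = q (\<lambda>j. g j - f j)"
  using qnorm_scale[of "\<lambda>j. f j - g j" "-1"] c00_diff[of f g] by simp

lemma qnorm_diff_triangle:
  assumes "f \<in> c00" "g \<in> c00" "k \<in> c00"
  shows "q (\<lambda>j. f j - k j) \<le> q (\<lambda>j. f j - g j) + q (\<lambda>j. g j - k j)"
  using qnorm_add[of "\<lambda>j. f j - g j" "\<lambda>j. g j - k j"] assms by (simp add: c00_diff)

lemma qnorm_reverse_triangle:
  assumes "f \<in> c00" "g \<in> c00"
  shows "\<bar>q f - q g\<bar> \<le> q (\<lambda>j. f j - g j)"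
  using qnorm_add[of "\<lambda>j. f j - g j" g] qnorm_add[of "\<lambda>j. g j - f j" f] assms
    qnorm_diff_commute[of f g] by (simp add: c00_diff abs_le_iff)

lemma qnorm_sum:
  "(\<And>i. i \<in> I \<Longrightarrow> f i \<in> c00) \<Longrightarrow> q (\<lambda>j. \<Sum>i\<in>I. c i * f i j) \<le> (\<Sum>i\<in>I. cmod (c i) * q (f i))"
proof (induction I rule: infinite_finite_induct)
  case (insert x I)
  have "q (\<lambda>j. \<Sum>i\<in>insert x I. c i * f i j) \<le> q (\<lambda>j. c x * f x j) + q (\<lambda>j. \<Sum>i\<in>I. c i * f i j)"
    using insert qnorm_add[of "\<lambda>j. c x * f x j" "\<lambda>j. \<Sum>i\<in>I. c i * f i j"]
    by (simp add: c00_scale c00_sum)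
  also have "\<dots> \<le> (\<Sum>i\<in>insert x I. cmod (c i) * q (f i))"
    using insert by (simp add: qnorm_scale)
  finally show ?case .
qed (simp_all add: qnorm_zero)

lemma qnorm_hseq: "q (h n) = \<phi> n"
proof -
  have "q (h n) = (\<Sum>i<Suc n. if i = n then \<phi> i else 0)"
    by (subst qnorm_eq[of "Suc n"])
       (auto simp: weyl_diff_hseq[OF \<alpha>] unit_seq_def intro!: sum.cong)
  then show ?thesis by simp
qed

text \<open>By the product formula and \<open>qnorm_hseq\<close>, the triangle inequality leaves,
  after reflecting the index, exactly the two sums bounded in \<open>omega_loc\<close>. This covers
  1 \<le> n \<le> m, and commutativity gives the case n > m.\<close>

lemma qnorm_conv_hseq:
  obtains M where "M > 0" "\<And>n m. q (conv (h n) (h m)) \<le> M * \<phi> n * \<phi> m"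
proof -
  obtain c where c: "c > 0" "\<And>j p. 1 \<le> j \<Longrightarrow> j \<le> p \<Longrightarrow>
      (\<Sum>n=0..j. ces \<alpha> n * \<phi> (j + p - n)) + (\<Sum>n=p+1..j+p. ces \<alpha> n * \<phi> (j + p - n)) \<le> c * \<phi> j * \<phi> p"
    using \<phi> by (auto simp: omega_def omega_loc_def)
  \<comment> \<open>The entry \<open>1 / \<phi> 0\<close> handles n = 0, outside the range of the
    weight condition, where the product is just \<open>h m\<close>.\<close>
  define M where "M = max c (1 / \<phi> 0)"
  have M: "c \<le> M" "1 \<le> M * \<phi> 0" "M > 0"
    using \<phi>_pos[of 0] c(1) by (auto simp: M_def max_def field_simps)
  have le: "q (conv (h n) (h m)) \<le> M * \<phi> n * \<phi> m" if nm: "n \<le> m" for n m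
  proof (cases "n = 0")
    case True
    then show ?thesis
      using mult_right_mono[OF M(2), of "\<phi> m"] \<phi>_pos[of m]
      by (simp add: hseq_0[OF \<alpha>] conv_unit_seq_0 qnorm_hseq less_imp_le)
  next
    case False
    have sum_le: "q (\<lambda>j. \<Sum>u\<in>I. of_real (ces \<alpha> (n + m - u)) * h u j) \<le> (\<Sum>u\<in>I. ces \<alpha> (n + m - u) * \<phi> u)" for I
      using qnorm_sum[of I h "\<lambda>u. of_real (ces \<alpha> (n + m - u))"]
      by (simp add: c00_hseq qnorm_hseq ces_nonneg[OF \<alpha>])
    have "conv (h n) (h m) = (\<lambda>j. (\<Sum>u=m..n+m. of_real (ces \<alpha> (n + m - u)) * h u j)
        - (\<Sum>u<n. of_real (ces \<alpha> (n + m - u)) * h u j))"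
      by (rule ext) (simp add: conv_hseq[OF \<alpha>] cesaro_product_rhs_def scaleR_conv_of_real)
    then have "q (conv (h n) (h m)) \<le> q (\<lambda>j. \<Sum>u=m..n+m. of_real (ces \<alpha> (n + m - u)) * h u j)
        + q (\<lambda>j. \<Sum>u<n. of_real (ces \<alpha> (n + m - u)) * h u j)"
      by (simp add: qnorm_diff c00_sum c00_hseq)
    also have "\<dots> \<le> (\<Sum>u=m..n+m. ces \<alpha> (n + m - u) * \<phi> u) + (\<Sum>u<n. ces \<alpha> (n + m - u) * \<phi> u)"
      by (intro add_mono sum_le)
    also have "(\<Sum>u=m..n+m. ces \<alpha> (n + m - u) * \<phi> u) = (\<Sum>v=0..n. ces \<alpha> v * \<phi> (n + m - v))"
      by (rule sum.reindex_bij_witness[where i = "\<lambda>v. n + m - v" and j = "\<lambda>u. n + m - u"]) auto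
    also have "(\<Sum>u<n. ces \<alpha> (n + m - u) * \<phi> u) = (\<Sum>v=m+1..n+m. ces \<alpha> v * \<phi> (n + m - v))"
      by (rule sum.reindex_bij_witness[where i = "\<lambda>v. n + m - v" and j = "\<lambda>u. n + m - u"]) auto
    finally have "q (conv (h n) (h m)) \<le> c * \<phi> n * \<phi> m"
      using c(2)[of n m] False nm by simp
    also have "\<dots> \<le> M * \<phi> n * \<phi> m"
      using M(1) \<phi>_pos by (intro mult_right_mono) (simp_all add: less_imp_le)
    finally show ?thesis .
  qed
  have "q (conv (h n) (h m)) \<le> M * \<phi> n * \<phi> m" for n m
  proof (cases "n \<le> m")
    case False
    then show ?thesis using le[of m n] by (simp add: conv_commute[of "h n"] mult_ac)
  qed (rule le)
  with M(3) show thesis by (rule that)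
qed

lemma conv_expansion:
  assumes "f = (\<lambda>j. \<Sum>n<N. W f n * h n j)" "g = (\<lambda>j. \<Sum>n<L. W g n * h n j)"
  shows "conv f g = (\<lambda>j. \<Sum>n<N. W f n * (\<Sum>m<L. W g m * conv (h n) (h m) j))"
  by (subst assms(1), subst assms(2)) (simp only: conv_sum_left conv_sum_right)

text \<open>Bilinear expansion in the \<open>h n\<close> reduces to the previous bound, and the
  double sum then factors into the two norms.\<close>

lemma qnorm_conv:
  obtains M where "M > 0" "\<And>f g. f \<in> c00 \<Longrightarrow> g \<in> c00 \<Longrightarrow> q (conv f g) \<le> M * q f * q g"
proof -
  obtain M where M: "M > 0" "\<And>n m. q (conv (h n) (h m)) \<le> M * \<phi> n * \<phi> m"
    using qnorm_conv_hseq by blast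
  have "q (conv f g) \<le> M * q f * q g" if fg: "f \<in> c00" "g \<in> c00" for f g
  proof -
    obtain N where N: "f = (\<lambda>j. \<Sum>n<N. W f n * h n j)" "\<And>n. n \<ge> N \<Longrightarrow> W f n = 0"
      using expansion[OF fg(1)] by blast
    obtain L where L: "g = (\<lambda>j. \<Sum>n<L. W g n * h n j)" "\<And>n. n \<ge> L \<Longrightarrow> W g n = 0"
      using expansion[OF fg(2)] by blast
    have "q (conv f g) \<le> (\<Sum>n<N. cmod (W f n) * q (\<lambda>j. \<Sum>m<L. W g m * conv (h n) (h m) j))"
      unfolding conv_expansion[OF N(1) L(1)] by (intro qnorm_sum c00_sum c00_conv c00_hseq)
    also have "\<dots> \<le> (\<Sum>n<N. cmod (W f n) * (\<Sum>m<L. cmod (W g m) * (M * \<phi> n * \<phi> m)))"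
      by (intro sum_mono mult_left_mono order_trans[OF qnorm_sum] M(2))
         (simp_all add: c00_conv c00_hseq)
    also have "\<dots> = M * q f * q g"
      by (simp add: qnorm_eq[OF N(2)] qnorm_eq[OF L(2)] sum_distrib_left sum_distrib_right mult_ac)
    finally show ?thesis .
  qed
  with M(1) show thesis by (rule that)
qed

end

section \<open>The functional calculus on the completion\<close>

context cesaro_weight
begin

abbreviation "cauchy \<equiv> tau_cauchy \<alpha> \<phi>"
abbreviation "rel \<equiv> tau_rel \<alpha> \<phi>"
abbreviation "cls u \<equiv> rel `` {u}"

lemma cauchy_c00: "u \<in> cauchy \<Longrightarrow> u k \<in> c00"
  by (simp add: tau_cauchy_def)

lemma cauchyD:
  "u \<in> cauchy \<Longrightarrow> \<epsilon> > 0 \<Longrightarrow> \<exists>N. \<forall>k\<ge>N. \<forall>l\<ge>N. q (\<lambda>j. u k j - u l j) < \<epsilon>"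
  by (simp add: tau_cauchy_def)

lemma relD:
  assumes "(u, v) \<in> rel"
  shows "u \<in> cauchy" "v \<in> cauchy" "(\<lambda>k. q (\<lambda>j. u k j - v k j)) \<longlonglongrightarrow> 0"
  using assms by (simp_all add: tau_rel_def)

lemma equiv_rel: "equiv cauchy rel"
proof (rule equivI)
  show "rel \<subseteq> cauchy \<times> cauchy"
    by (auto simp: tau_rel_def)
  show "refl_on cauchy rel"
    by (auto simp: refl_on_def tau_rel_def qnorm_zero)
  show "sym rel"
  proof (rule symI)
    fix u v assume uv: "(u, v) \<in> rel"
    have "q (\<lambda>j. v k j - u k j) = q (\<lambda>j. u k j - v k j)" for k
      by (intro qnorm_diff_commute cauchy_c00 relD[OF uv])
    then show "(v, u) \<in> rel"
      using uv by (simp add: tau_rel_def)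
  qed
  show "trans rel"
  proof (rule transI)
    fix u v w assume uv: "(u, v) \<in> rel" and vw: "(v, w) \<in> rel"
    have "(\<lambda>k. q (\<lambda>j. u k j - v k j) + q (\<lambda>j. v k j - w k j)) \<longlonglongrightarrow> 0"
      using tendsto_add[OF relD(3)[OF uv] relD(3)[OF vw]] by simp
    then have "(\<lambda>k. q (\<lambda>j. u k j - w k j)) \<longlonglongrightarrow> 0"
      by (rule real_tendsto_sandwich[OF _ _ tendsto_const, rotated 2])
         (use relD[OF uv] relD[OF vw] in \<open>auto simp: qnorm_nonneg qnorm_diff_triangle cauchy_c00 c00_diff\<close>)
    then show "(u, w) \<in> rel"
      using relD[OF uv] relD[OF vw] by (simp add: tau_rel_def)
  qed
qed

text \<open>A common criterion by which termwise sums, multiples and convolutions stay Cauchy;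
  \<open>relI_dominated\<close> is its counterpart for independence of representatives.\<close>

lemma cauchyI_dominated:
  assumes u: "u \<in> cauchy" and v: "v \<in> cauchy" and "K > 0" and c00: "\<And>k. w k \<in> c00"
    and le: "\<And>k l. q (\<lambda>j. w k j - w l j) \<le> K * (q (\<lambda>j. u k j - u l j) + q (\<lambda>j. v k j - v l j))"
  shows "w \<in> cauchy"
  unfolding tau_cauchy_def
proof (intro CollectI conjI allI impI c00)
  fix \<epsilon> :: real assume "\<epsilon> > 0"
  then have \<epsilon>: "\<epsilon> / (2 * K) > 0" using \<open>K > 0\<close> by simp
  obtain M N where M: "\<And>k l. k \<ge> M \<Longrightarrow> l \<ge> M \<Longrightarrow> q (\<lambda>j. u k j - u l j) < \<epsilon> / (2 * K)"
    and N: "\<And>k l. k \<ge> N \<Longrightarrow> l \<ge> N \<Longrightarrow> q (\<lambda>j. v k j - v l j) < \<epsilon> / (2 * K)"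
    using cauchyD[OF u \<epsilon>] cauchyD[OF v \<epsilon>] by blast
  have "q (\<lambda>j. w k j - w l j) < \<epsilon>" if "k \<ge> max M N" "l \<ge> max M N" for k l
  proof -
    have "K * (q (\<lambda>j. u k j - u l j) + q (\<lambda>j. v k j - v l j)) < K * (\<epsilon> / (2 * K) + \<epsilon> / (2 * K))"
      using M[of k l] N[of k l] that \<open>K > 0\<close> by (intro mult_strict_left_mono add_strict_mono) auto
    then show ?thesis
      using le[of k l] \<open>K > 0\<close> by simp
  qed
  then show "\<exists>N. \<forall>k\<ge>N. \<forall>l\<ge>N. q (\<lambda>j. w k j - w l j) < \<epsilon>"
    by blast
qed

lemma relI_dominated:
  assumes u: "(u, u') \<in> rel" and v: "(v, v') \<in> rel" and w: "w \<in> cauchy" "w' \<in> cauchy"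
    and le: "\<And>k. q (\<lambda>j. w k j - w' k j) \<le> K * (q (\<lambda>j. u k j - u' k j) + q (\<lambda>j. v k j - v' k j))"
  shows "(w, w') \<in> rel"
proof -
  have "(\<lambda>k. K * (q (\<lambda>j. u k j - u' k j) + q (\<lambda>j. v k j - v' k j))) \<longlonglongrightarrow> K * (0 + 0)"
    by (intro tendsto_intros relD(3) u v)
  then have "(\<lambda>k. K * (q (\<lambda>j. u k j - u' k j) + q (\<lambda>j. v k j - v' k j))) \<longlonglongrightarrow> 0"
    by simp
  then have "(\<lambda>k. q (\<lambda>j. w k j - w' k j)) \<longlonglongrightarrow> 0"
    by (rule real_tendsto_sandwich[OF _ _ tendsto_const, rotated 2])
       (use le w in \<open>auto simp: qnorm_nonneg cauchy_c00 c00_diff\<close>)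
  with w show ?thesis by (simp add: tau_rel_def)
qed

text \<open>Needed for products, since the Lipschitz constant of convolution depends on the size of
  the factors.\<close>

lemma cauchy_bounded:
  assumes "u \<in> cauchy"
  obtains B where "B > 0" "\<And>k. q (u k) \<le> B"
proof -
  have "Cauchy (\<lambda>k. q (u k))"
  proof (rule metric_CauchyI)
    fix \<epsilon> :: real assume "\<epsilon> > 0"
    then obtain N where "\<forall>k\<ge>N. \<forall>l\<ge>N. q (\<lambda>j. u k j - u l j) < \<epsilon>"
      using cauchyD[OF assms] by blast
    then show "\<exists>N. \<forall>k\<ge>N. \<forall>l\<ge>N. dist (q (u k)) (q (u l)) < \<epsilon>"
      unfolding dist_real_def
      using qnorm_reverse_triangle[OF cauchy_c00[OF assms] cauchy_c00[OF assms]] order_le_less_trans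
      by blast
  qed
  then have "Bseq (\<lambda>k. q (u k))" by (rule Cauchy_Bseq)
  then obtain B where B: "B > 0" "\<forall>k. norm (q (u k)) \<le> B" by (rule BseqE)
  then have "q (u k) \<le> B" for k
    using abs_le_D1 by auto
  with B(1) show thesis by (rule that)
qed

lemma qnorm_conv_diff:
  assumes M: "M > 0" "\<And>f g. f \<in> c00 \<Longrightarrow> g \<in> c00 \<Longrightarrow> q (conv f g) \<le> M * q f * q g"
    and c00: "f \<in> c00" "f' \<in> c00" "g \<in> c00" "g' \<in> c00" and B: "q g \<le> B" "q f' \<le> B"
  shows "q (\<lambda>j. conv f g j - conv f' g' j) \<le> M * B * (q (\<lambda>j. f j - f' j) + q (\<lambda>j. g j - g' j))"
proof -
  have "q (\<lambda>j. conv f g j - conv f' g' j)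
      \<le> q (conv (\<lambda>j. f j - f' j) g) + q (conv f' (\<lambda>j. g j - g' j))"
    unfolding conv_diff by (intro qnorm_add c00_conv c00_diff c00)
  also have "\<dots> \<le> M * q (\<lambda>j. f j - f' j) * q g + M * q f' * q (\<lambda>j. g j - g' j)"
    by (intro add_mono M(2) c00_diff c00)
  also have "\<dots> \<le> M * q (\<lambda>j. f j - f' j) * B + M * B * q (\<lambda>j. g j - g' j)"
    using M(1) B by (intro add_mono mult_mono mult_nonneg_nonneg order_refl)
      (auto intro!: qnorm_nonneg c00 c00_diff intro: order_trans[OF qnorm_nonneg[OF c00(2)]])
  finally show ?thesis by (simp add: algebra_simps)
qed

lemma cauchy_add:
  assumes "u \<in> cauchy" "v \<in> cauchy"
  shows "(\<lambda>k j. u k j + v k j) \<in> cauchy"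
proof (rule cauchyI_dominated[OF assms, of 1])
  fix k l
  show "q (\<lambda>j. u k j + v k j - (u l j + v l j))
      \<le> 1 * (q (\<lambda>j. u k j - u l j) + q (\<lambda>j. v k j - v l j))"
    using qnorm_add[of "\<lambda>j. u k j - u l j" "\<lambda>j. v k j - v l j"] assms
    by (simp add: cauchy_c00 c00_diff algebra_simps)
qed (use assms in \<open>simp_all add: c00_add cauchy_c00\<close>)

lemma cauchy_scale:
  assumes "u \<in> cauchy"
  shows "(\<lambda>k j. c * u k j) \<in> cauchy"
proof (rule cauchyI_dominated[OF assms assms, of "cmod c + 1"])
  fix k l
  have "q (\<lambda>j. c * u k j - c * u l j) = cmod c * q (\<lambda>j. u k j - u l j)"
    using qnorm_scale[of "\<lambda>j. u k j - u l j" c] assms by (simp add: cauchy_c00 c00_diff algebra_simps)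
  also have "\<dots> \<le> (cmod c + 1) * (q (\<lambda>j. u k j - u l j) + q (\<lambda>j. u k j - u l j))"
    using assms by (intro mult_mono) (auto simp: qnorm_nonneg cauchy_c00 c00_diff)
  finally show "q (\<lambda>j. c * u k j - c * u l j)
      \<le> (cmod c + 1) * (q (\<lambda>j. u k j - u l j) + q (\<lambda>j. u k j - u l j))" .
qed (use assms in \<open>simp_all add: c00_scale cauchy_c00 add_nonneg_pos\<close>)

lemma cauchy_conv:
  assumes "u \<in> cauchy" "v \<in> cauchy"
  shows "(\<lambda>k. conv (u k) (v k)) \<in> cauchy"
proof -
  obtain M where M: "M > 0" "\<And>f g. f \<in> c00 \<Longrightarrow> g \<in> c00 \<Longrightarrow> q (conv f g) \<le> M * q f * q g"
    using qnorm_conv by blast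
  obtain B B' where B: "B > 0" "\<And>k. q (u k) \<le> B" "\<And>k. q (v k) \<le> B'"
    using cauchy_bounded assms by metis
  define D where "D = max B B'"
  have D: "D > 0" "\<And>k. q (u k) \<le> D" "\<And>k. q (v k) \<le> D"
    using B by (simp_all add: D_def max.coboundedI1 max.coboundedI2 less_max_iff_disj)
  show ?thesis
    by (rule cauchyI_dominated[OF assms, of "M * D"])
       (use M D assms in \<open>simp_all add: c00_conv cauchy_c00 qnorm_conv_diff\<close>)
qed

text \<open>The union over all representatives collapses to a single class once that class is
  independent of them. Scaling and multiplication follow the same pattern.\<close>

lemma tau_add_cls:
  assumes "u \<in> cauchy" "v \<in> cauchy"
  shows "tau_add \<alpha> \<phi> (cls u) (cls v) = cls (\<lambda>k j. u k j + v k j)"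
  unfolding tau_add_def
proof (rule UN_equiv_class2[OF equiv_rel equiv_rel _ assms], rule congruent2I')
  fix u u' v v' assume uv: "(u, u') \<in> rel" "(v, v') \<in> rel"
  note c = relD(1,2)[OF uv(1)] relD(1,2)[OF uv(2)]
  show "cls (\<lambda>k j. u k j + v k j) = cls (\<lambda>k j. u' k j + v' k j)"
  proof (rule equiv_class_eq[OF equiv_rel], rule relI_dominated[OF uv cauchy_add cauchy_add])
    fix k
    show "q (\<lambda>j. u k j + v k j - (u' k j + v' k j))
        \<le> 1 * (q (\<lambda>j. u k j - u' k j) + q (\<lambda>j. v k j - v' k j))"
      using qnorm_add[of "\<lambda>j. u k j - u' k j" "\<lambda>j. v k j - v' k j"] c
      by (simp add: cauchy_c00 c00_diff algebra_simps)
  qed (use c in auto)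
qed

lemma tau_scale_cls:
  assumes "u \<in> cauchy"
  shows "tau_scale \<alpha> \<phi> c (cls u) = cls (\<lambda>k j. c * u k j)"
  unfolding tau_scale_def
proof (rule UN_equiv_class[OF equiv_rel _ assms], rule congruentI)
  fix u u' assume uu': "(u, u') \<in> rel"
  note c = relD(1,2)[OF uu']
  show "cls (\<lambda>k j. c * u k j) = cls (\<lambda>k j. c * u' k j)"
  proof (rule equiv_class_eq[OF equiv_rel], rule relI_dominated[OF uu' uu' cauchy_scale cauchy_scale])
    fix k
    have "q (\<lambda>j. c * u k j - c * u' k j) = cmod c * q (\<lambda>j. u k j - u' k j)"
      using qnorm_scale[of "\<lambda>j. u k j - u' k j" c] c by (simp add: cauchy_c00 c00_diff algebra_simps)
    also have "\<dots> \<le> cmod c * (q (\<lambda>j. u k j - u' k j) + q (\<lambda>j. u k j - u' k j))"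
      using c by (intro mult_left_mono) (auto simp: qnorm_nonneg cauchy_c00 c00_diff)
    finally show "q (\<lambda>j. c * u k j - c * u' k j)
        \<le> cmod c * (q (\<lambda>j. u k j - u' k j) + q (\<lambda>j. u k j - u' k j))" .
  qed (use c in auto)
qed

lemma tau_mult_cls:
  assumes "u \<in> cauchy" "v \<in> cauchy"
  shows "tau_mult \<alpha> \<phi> (cls u) (cls v) = cls (\<lambda>k. conv (u k) (v k))"
  unfolding tau_mult_def
proof (rule UN_equiv_class2[OF equiv_rel equiv_rel _ assms], rule congruent2I')
  fix u u' v v' assume uv: "(u, u') \<in> rel" "(v, v') \<in> rel"
  note c = relD(1,2)[OF uv(1)] relD(1,2)[OF uv(2)]
  obtain M where M: "M > 0" "\<And>f g. f \<in> c00 \<Longrightarrow> g \<in> c00 \<Longrightarrow> q (conv f g) \<le> M * q f * q g"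
    using qnorm_conv by blast
  \<comment> \<open>The bounds concern \<open>u'\<close> and \<open>v\<close>, the factors that
    \<open>conv_diff\<close> leaves undifferenced.\<close>
  obtain B B' where B: "\<And>k. q (u' k) \<le> B" "\<And>k. q (v k) \<le> B'"
    using cauchy_bounded c by metis
  define D where "D = max B B'"
  have D: "\<And>k. q (u' k) \<le> D" "\<And>k. q (v k) \<le> D"
    using B by (simp_all add: D_def max.coboundedI1 max.coboundedI2)
  show "cls (\<lambda>k. conv (u k) (v k)) = cls (\<lambda>k. conv (u' k) (v' k))"
    by (rule equiv_class_eq[OF equiv_rel], rule relI_dominated[OF uv cauchy_conv cauchy_conv, where K = "M * D"])
       (use M D c in \<open>simp_all add: cauchy_c00 qnorm_conv_diff\<close>)
qed

section \<open>Embedding into the completion and extension by continuity\<close>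

lemma cauchy_const: "f \<in> c00 \<Longrightarrow> (\<lambda>_. f) \<in> cauchy"
  by (simp add: tau_cauchy_def qnorm_zero)

lemma tau_embed_in_tau: "f \<in> c00 \<Longrightarrow> tau_embed \<alpha> \<phi> f \<in> tau \<alpha> \<phi>"
  unfolding tau_embed_def tau_def by (intro quotientI cauchy_const)

lemma tau_embed_add:
  "f \<in> c00 \<Longrightarrow> g \<in> c00 \<Longrightarrow>
    tau_embed \<alpha> \<phi> (\<lambda>j. f j + g j) = tau_add \<alpha> \<phi> (tau_embed \<alpha> \<phi> f) (tau_embed \<alpha> \<phi> g)"
  by (simp add: tau_embed_def tau_add_cls cauchy_const)

lemma tau_embed_scale:
  "f \<in> c00 \<Longrightarrow> tau_embed \<alpha> \<phi> (\<lambda>j. c * f j) = tau_scale \<alpha> \<phi> c (tau_embed \<alpha> \<phi> f)"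
  by (simp add: tau_embed_def tau_scale_cls cauchy_const)

lemma tau_embed_conv:
  "f \<in> c00 \<Longrightarrow> g \<in> c00 \<Longrightarrow>
    tau_embed \<alpha> \<phi> (conv f g) = tau_mult \<alpha> \<phi> (tau_embed \<alpha> \<phi> f) (tau_embed \<alpha> \<phi> g)"
  by (simp add: tau_embed_def tau_mult_cls cauchy_const)

text \<open>The common limit along all representatives; for \<open>F\<close> = \<open>q\<close> this
  is \<open>tau_norm\<close>.\<close>

definition extension :: "((nat \<Rightarrow> complex) \<Rightarrow> 'b::banach) \<Rightarrow> tau_elem \<Rightarrow> 'b" where
  "extension F X = (THE l. \<forall>u\<in>X. (\<lambda>k. F (u k)) \<longlonglongrightarrow> l)"

text \<open>Lipschitz maps preserve Cauchy sequences and send equivalent ones to sequences with the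
  same limit. The estimate takes the place of linearity so that the norm itself is an
  instance.\<close>

lemma extension_tendsto:
  fixes F :: "(nat \<Rightarrow> complex) \<Rightarrow> 'b::banach"
  assumes lip: "\<And>f g. f \<in> c00 \<Longrightarrow> g \<in> c00 \<Longrightarrow> norm (F f - F g) \<le> K * q (\<lambda>j. f j - g j)"
    and u: "u \<in> cauchy"
  shows "(\<lambda>k. F (u k)) \<longlonglongrightarrow> extension F (cls u)"
proof -
  \<comment> \<open>A positive constant, so that \<epsilon> can be divided by it.\<close>
  define K' where "K' = \<bar>K\<bar> + 1"
  have K': "K' > 0" by (simp add: K'_def)
  have lip': "norm (F f - F g) \<le> K' * q (\<lambda>j. f j - g j)" if "f \<in> c00" "g \<in> c00" for f g
  proof (rule order_trans[OF lip[OF that]])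
    show "K * q (\<lambda>j. f j - g j) \<le> K' * q (\<lambda>j. f j - g j)"
      using that by (intro mult_right_mono qnorm_nonneg c00_diff) (auto simp: K'_def)
  qed
  have "Cauchy (\<lambda>k. F (u k))"
  proof (rule metric_CauchyI)
    fix \<epsilon> :: real assume "\<epsilon> > 0"
    then have "\<epsilon> / K' > 0" using K' by simp
    then obtain N where N: "\<And>k l. k \<ge> N \<Longrightarrow> l \<ge> N \<Longrightarrow> q (\<lambda>j. u k j - u l j) < \<epsilon> / K'"
      using cauchyD[OF u] by blast
    have "dist (F (u k)) (F (u l)) < \<epsilon>" if "k \<ge> N" "l \<ge> N" for k l
      using N[OF that] lip'[OF cauchy_c00[OF u] cauchy_c00[OF u], of k l] K'
      by (simp add: dist_norm field_simps)
    then show "\<exists>N. \<forall>k\<ge>N. \<forall>l\<ge>N. dist (F (u k)) (F (u l)) < \<epsilon>" by blast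
  qed
  then obtain L where L: "(\<lambda>k. F (u k)) \<longlonglongrightarrow> L"
    using Cauchy_convergent convergent_def by blast
  have Lv: "(\<lambda>k. F (v k)) \<longlonglongrightarrow> L" if "v \<in> cls u" for v
  proof -
    have uv: "(u, v) \<in> rel" using that by simp
    have "(\<lambda>k. K' * q (\<lambda>j. u k j - v k j)) \<longlonglongrightarrow> 0"
      using tendsto_mult_right_zero[OF relD(3)[OF uv]] .
    moreover have "\<forall>\<^sub>F k in sequentially. norm (F (u k) - F (v k)) \<le> K' * q (\<lambda>j. u k j - v k j)"
      using relD[OF uv] by (simp add: lip' cauchy_c00)
    ultimately have "(\<lambda>k. F (u k) - F (v k)) \<longlonglongrightarrow> 0"
      by (rule Lim_null_comparison[rotated])
    from tendsto_diff[OF L this] show ?thesis by simp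
  qed
  have "u \<in> cls u"
    using equiv_class_self[OF equiv_rel u] .
  then have "extension F (cls u) = L"
    unfolding extension_def using Lv L by (intro the_equality) (auto intro: LIMSEQ_unique)
  with L show ?thesis by simp
qed

lemma tau_norm_tendsto: "u \<in> cauchy \<Longrightarrow> (\<lambda>k. q (u k)) \<longlonglongrightarrow> tau_norm \<alpha> \<phi> (cls u)"
  using extension_tendsto[of q 1 u] qnorm_reverse_triangle
  by (simp add: tau_norm_def extension_def)

lemma tauE:
  assumes "X \<in> tau \<alpha> \<phi>"
  obtains u where "u \<in> cauchy" "X = cls u"
  using assms unfolding tau_def by (auto elim!: quotientE)

end

section \<open>The functional calculus of the operator family\<close>

locale cesaro_family = cesaro_weight \<alpha> \<phi> for \<alpha> \<phi> +
  fixes T :: "nat \<Rightarrow> ('a::complex_banach \<Rightarrow>\<^sub>L 'a)" and C :: real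
  assumes T: "\<And>n. T n \<in> bounded_ops" and T0: "T 0 = id_blinfun"
    and T_le: "\<And>n. norm (T n) \<le> C * \<phi> n"
begin

text \<open>The formula is forced: \<open>f\<close> is the combination of the \<open>h n\<close>
  with coefficients \<open>W f n\<close>, and \<open>h n\<close> has to go to \<open>T n\<close>. On
  \<open>c00\<close> the series is a finite sum.\<close>

definition calculus :: "(nat \<Rightarrow> complex) \<Rightarrow> ('a \<Rightarrow>\<^sub>L 'a)" where
  "calculus f = (\<Sum>n. W f n *\<^sub>C T n)"

lemma calculus_eq: "(\<And>n. n \<ge> N \<Longrightarrow> W f n = 0) \<Longrightarrow> calculus f = (\<Sum>n<N. W f n *\<^sub>C T n)"
  unfolding calculus_def by (rule suminf_finite) (auto simp: not_less[symmetric])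

lemma summable_calculus:
  assumes "f \<in> c00"
  shows "summable (\<lambda>n. W f n *\<^sub>C T n)"
proof (rule summable_finite)
  show "finite {n. W f n \<noteq> 0}"
    using weyl_diff_in_c00[OF \<alpha> assms] by (simp add: c00_def)
qed auto

lemma calculus_in_bounded_ops: "f \<in> c00 \<Longrightarrow> calculus f \<in> bounded_ops"
  unfolding calculus_def by (intro suminf_in_bounded_ops summable_calculus scaleC_in_bounded_ops T)

lemma calculus_add: "f \<in> c00 \<Longrightarrow> g \<in> c00 \<Longrightarrow> calculus (\<lambda>j. f j + g j) = calculus f + calculus g"
  by (simp add: calculus_def weyl_diff_add scaleC_add_left suminf_add summable_calculus)

lemma calculus_scale: "f \<in> c00 \<Longrightarrow> calculus (\<lambda>j. c * f j) = c *\<^sub>C calculus f"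
  using bounded_linear.suminf[OF scaleC.bounded_linear_right summable_calculus, of f c]
  by (simp add: calculus_def weyl_diff_scale scaleC_scaleC)

lemma calculus_diff: "f \<in> c00 \<Longrightarrow> g \<in> c00 \<Longrightarrow> calculus (\<lambda>j. f j - g j) = calculus f - calculus g"
  using calculus_add[of f "\<lambda>j. -1 * g j"] calculus_scale[of g "-1"] c00_scale[of g "-1"]
  by (simp add: scaleC.minus_left)

lemma calculus_sum:
  "(\<And>i. i \<in> I \<Longrightarrow> f i \<in> c00) \<Longrightarrow> calculus (\<lambda>j. \<Sum>i\<in>I. c i * f i j) = (\<Sum>i\<in>I. c i *\<^sub>C calculus (f i))"
proof (induction I rule: infinite_finite_induct)
  case (insert x I)
  then show ?case
    by (simp add: calculus_add calculus_scale c00_sum c00_scale)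
qed (use calculus_scale[of "\<lambda>_. 0" 0] c00_zero in simp_all)

lemma norm_calculus: "f \<in> c00 \<Longrightarrow> norm (calculus f) \<le> C * q f"
proof -
  assume f: "f \<in> c00"
  have "norm (calculus f) \<le> (\<Sum>n. C * (\<phi> n * cmod (W f n)))"
    unfolding calculus_def
  proof (rule norm_suminf_le)
    show "norm (W f n *\<^sub>C T n) \<le> C * (\<phi> n * cmod (W f n))" for n
      using mult_left_mono[OF T_le[of n], of "cmod (W f n)"] by (simp add: norm_scaleC mult_ac)
  qed (intro summable_mult summable_qnorm f)
  also have "\<dots> = C * q f"
    unfolding qnorm_def by (rule suminf_mult[OF summable_qnorm[OF f]])
  finally show ?thesis .
qed

lemma calculus_hseq: "calculus (h n) = T n"
proof -
  have "calculus (h n) = (\<Sum>i<Suc n. if i = n then T i else 0)"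
    by (subst calculus_eq[of "Suc n"])
       (auto simp: weyl_diff_hseq[OF \<alpha>] unit_seq_def intro!: sum.cong)
  then show ?thesis by simp
qed

text \<open>Products of the \<open>h n\<close> and of the \<open>T n\<close> expand by the same
  \<open>cesaro_product_rhs\<close>, so multiplicativity holds for them and spreads
  bilinearly.\<close>

lemma calculus_conv:
  assumes feq: "cesaro_functional_eq \<alpha> T" and f: "f \<in> c00" and g: "g \<in> c00"
  shows "calculus (conv f g) = calculus f o\<^sub>L calculus g"
proof -
  have hh: "calculus (conv (h n) (h m)) = T n o\<^sub>L T m" for n m
  proof -
    have "conv (h n) (h m) = (\<lambda>j. (\<Sum>u=m..n+m. of_real (ces \<alpha> (n + m - u)) * h u j)
        - (\<Sum>u<n. of_real (ces \<alpha> (n + m - u)) * h u j))"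
      by (rule ext) (simp add: conv_hseq[OF \<alpha>] cesaro_product_rhs_def scaleR_conv_of_real)
    then have "calculus (conv (h n) (h m)) = cesaro_product_rhs (ces \<alpha>) T n m"
      by (simp add: calculus_diff calculus_sum c00_sum c00_hseq calculus_hseq
          cesaro_product_rhs_def scaleR_scaleC)
    with feq show ?thesis
      by (simp only: cesaro_functional_eq_iff[of \<alpha> T, OF \<alpha> T0])
  qed
  obtain N where N: "f = (\<lambda>j. \<Sum>n<N. W f n * h n j)" "\<And>n. n \<ge> N \<Longrightarrow> W f n = 0"
    using expansion[OF f] by blast
  obtain L where L: "g = (\<lambda>j. \<Sum>n<L. W g n * h n j)" "\<And>n. n \<ge> L \<Longrightarrow> W g n = 0"
    using expansion[OF g] by blast
  have "calculus (conv f g) = (\<Sum>n<N. W f n *\<^sub>C (\<Sum>m<L. W g m *\<^sub>C (T n o\<^sub>L T m)))"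
    unfolding conv_expansion[OF N(1) L(1)]
    by (simp add: calculus_sum c00_sum c00_conv c00_hseq hh)
  also have "\<dots> = calculus f o\<^sub>L calculus g"
    by (simp add: calculus_eq[OF N(2)] calculus_eq[OF L(2)] blinfun_compose.sum_left
        blinfun_compose.sum_right scaleC_blinfun_compose_left scaleC_blinfun_compose_right[OF T]
        scaleC.sum_right sum.swap[of _ "{..<N}"])
  finally show ?thesis .
qed

lemma extension_calculus:
  assumes "u \<in> cauchy"
  shows "(\<lambda>k. calculus (u k)) \<longlonglongrightarrow> extension calculus (cls u)"
proof (rule extension_tendsto[OF _ assms])
  show "norm (calculus f - calculus g) \<le> C * q (\<lambda>j. f j - g j)" if "f \<in> c00" "g \<in> c00" for f g
    using norm_calculus[OF c00_diff[OF that]] by (simp add: calculus_diff[OF that])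
qed

text \<open>Every identity holds along representatives and passes to the limit; complex-linearity
  survives because \<open>bounded_ops\<close> is closed.\<close>

lemma represents_extension:
  assumes feq: "cesaro_functional_eq \<alpha> T"
  shows "represents \<alpha> \<phi> T (extension calculus)"
  unfolding represents_def bounded_alg_hom_def
proof (intro conjI ballI allI exI[of _ C])
  fix X assume "X \<in> tau \<alpha> \<phi>"
  then obtain u where u: "u \<in> cauchy" "X = cls u" by (rule tauE)
  note X = extension_calculus[OF u(1), folded u(2)]
  show "extension calculus X \<in> bounded_ops"
    using closed_sequentially[OF closed_bounded_ops _ X] u(1)
    by (simp add: calculus_in_bounded_ops cauchy_c00)
  show "norm (extension calculus X) \<le> C * tau_norm \<alpha> \<phi> X"
    by (rule LIMSEQ_le[OF tendsto_norm[OF X]])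
       (use tendsto_mult_left[OF tau_norm_tendsto[OF u(1)], of C] u norm_calculus cauchy_c00 in auto)
  show "extension calculus (tau_scale \<alpha> \<phi> c X) x = c *\<^sub>C extension calculus X x" for c x
  proof -
    have "(\<lambda>k. c *\<^sub>C calculus (u k)) \<longlonglongrightarrow> c *\<^sub>C extension calculus X"
      by (intro scaleC.tendsto tendsto_const X)
    then have "extension calculus (tau_scale \<alpha> \<phi> c X) = c *\<^sub>C extension calculus X"
      using extension_calculus[OF cauchy_scale[OF u(1)], of c] u(1)
      by (simp add: u(2) tau_scale_cls calculus_scale cauchy_c00 LIMSEQ_unique)
    then show ?thesis by (simp add: scaleC_blinfun_apply)
  qed
  fix Y assume "Y \<in> tau \<alpha> \<phi>"
  then obtain v where v: "v \<in> cauchy" "Y = cls v" by (rule tauE)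
  note Y = extension_calculus[OF v(1), folded v(2)]
  show "extension calculus (tau_add \<alpha> \<phi> X Y) = extension calculus X + extension calculus Y"
    using tendsto_add[OF X Y] extension_calculus[OF cauchy_add[OF u(1) v(1)]] u(1) v(1)
    by (simp add: u(2) v(2) tau_add_cls calculus_add cauchy_c00 LIMSEQ_unique)
  show "extension calculus (tau_mult \<alpha> \<phi> X Y) = extension calculus X o\<^sub>L extension calculus Y"
    using blinfun_compose.tendsto[OF X Y] extension_calculus[OF cauchy_conv[OF u(1) v(1)]] u(1) v(1)
    by (simp add: u(2) v(2) tau_mult_cls calculus_conv[OF feq] cauchy_c00 LIMSEQ_unique)
next
  fix n
  show "extension calculus (tau_embed \<alpha> \<phi> (h n)) = T n"
    using extension_calculus[OF cauchy_const[OF c00_hseq[of \<alpha> n]]]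
    by (simp add: tau_embed_def calculus_hseq LIMSEQ_const_iff)
qed

section \<open>From a homomorphism back to the recurrence\<close>

context
  fixes \<theta> assumes rep: "represents \<alpha> \<phi> T \<theta>"
begin

abbreviation "\<theta>' f \<equiv> \<theta> (tau_embed \<alpha> \<phi> f)"

lemma represents_embed:
  shows "\<theta>' (h n) = T n"
    and "f \<in> c00 \<Longrightarrow> g \<in> c00 \<Longrightarrow> \<theta>' (\<lambda>j. f j + g j) = \<theta>' f + \<theta>' g"
    and "f \<in> c00 \<Longrightarrow> \<theta>' (\<lambda>j. c * f j) = c *\<^sub>C \<theta>' f"
    and "f \<in> c00 \<Longrightarrow> g \<in> c00 \<Longrightarrow> \<theta>' (conv f g) = \<theta>' f o\<^sub>L \<theta>' g"
  using rep
  by (simp_all add: represents_def bounded_alg_hom_def tau_embed_add tau_embed_scale tau_embed_conv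
      tau_embed_in_tau blinfun_eqI scaleC_blinfun_apply)

text \<open>Apply the homomorphism to h 1 = e 1 + \<alpha> h 0, with \<open>h 0\<close> going to
  \<open>T 0\<close>, the identity.\<close>

lemma represents_unit_seq_1: "\<theta>' (unit_seq 1) = T 1 - \<alpha> *\<^sub>R id_blinfun"
proof -
  have "T 1 = \<theta>' (\<lambda>j. unit_seq 1 j + of_real \<alpha> * h 0 j)"
    using represents_embed(1)[of 1] by (simp add: hseq_Suc_0[OF \<alpha>] hseq_0[OF \<alpha>])
  also have "\<dots> = \<theta>' (unit_seq 1) + \<alpha> *\<^sub>R T 0"
    by (simp add: represents_embed c00_unit_seq c00_hseq c00_scale scaleR_scaleC)
  finally show ?thesis by (simp add: T0)
qed

text \<open>Convolution with e 1 is the right shift, so h (n + 1) = e 1 * h n + k (n + 1) h 0; the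
  homomorphism carries this identity to the operators.\<close>

lemma represents_imp_recurrence: "cesaro_recurrence \<alpha> T"
  unfolding cesaro_recurrence_def
proof
  fix n
  have "h (Suc n) = (\<lambda>j. conv (unit_seq 1) (h n) j + of_real (ces \<alpha> (Suc n)) * h 0 j)"
  proof
    fix j
    have "conv (unit_seq 1) (h n) j = (\<Sum>i=0..j. if Suc i = j then h n i else 0)"
      unfolding conv_def by (intro sum.cong refl) (auto simp: unit_seq_def)
    also have "\<dots> = (case j of 0 \<Rightarrow> 0 | Suc i \<Rightarrow> h n i)"
      by (auto split: nat.split)
    finally show "h (Suc n) j = conv (unit_seq 1) (h n) j + of_real (ces \<alpha> (Suc n)) * h 0 j"
      by (auto simp: hseq_def \<alpha> split: nat.split)
  qed
  then have "T (Suc n) = \<theta>' (\<lambda>j. conv (unit_seq 1) (h n) j + of_real (ces \<alpha> (Suc n)) * h 0 j)"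
    using represents_embed(1)[of "Suc n"] by simp
  also have "\<dots> = (\<theta>' (unit_seq 1) o\<^sub>L T n) + ces \<alpha> (Suc n) *\<^sub>R id_blinfun"
    by (simp add: represents_embed c00_unit_seq c00_hseq c00_scale c00_conv T0 scaleR_scaleC)
  finally show "T (Suc n) = ((T 1 - \<alpha> *\<^sub>R id_blinfun) o\<^sub>L T n) + ces \<alpha> (Suc n) *\<^sub>R id_blinfun"
    by (simp only: represents_unit_seq_1)
qed

end

end

section \<open>The equivalences and the resolvent of the generator\<close>

theorem theorem4:
  fixes \<alpha> a C C' :: real
    and \<phi> :: "nat \<Rightarrow> real"
    and T :: "nat \<Rightarrow> ('a::complex_banach \<Rightarrow>\<^sub>L 'a)"
  assumes "\<alpha> \<ge> 0"
    and "\<phi> \<in> omega \<alpha>"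
    and "a > 1"
    and "C > 0"
    and "C' > 0"
    and "\<And>n. T n \<in> bounded_ops"
    and "T 0 = id_blinfun"
    and "\<And>n. norm (T n) \<le> C * \<phi> n"
    and "\<And>n. C * \<phi> n \<le> C' * a ^ n"
  shows "(cesaro_functional_eq \<alpha> T \<longleftrightarrow> (\<exists>\<theta>. represents \<alpha> \<phi> T \<theta>)) \<and>
    ((\<exists>\<theta>. represents \<alpha> \<phi> T \<theta>) \<longleftrightarrow>
      pseudo_resolvent {z. cmod z > a} (cesaro_resolvent \<alpha> T)) \<and>
    (cesaro_functional_eq \<alpha> T \<longrightarrow>
      (let S = T 1 - \<alpha> *\<^sub>R id_blinfun in
        (\<forall>n. T n = cesaro_sum \<alpha> S n) \<and>
        (\<forall>\<theta>. represents \<alpha> \<phi> T \<theta> \<longrightarrow> \<theta> (tau_embed \<alpha> \<phi> (unit_seq 1)) = S) \<and>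
        {z. cmod z > a} \<subseteq> resolvent_set S \<and>
        (\<forall>z. cmod z > a \<longrightarrow> cesaro_resolvent \<alpha> T z = inv (\<lambda>x. z *\<^sub>C x - S x))))"
proof -
  interpret cesaro_family \<alpha> \<phi> T C
    using assms by unfold_locales
  have bound: "norm (T n) \<le> C' * a ^ n" for n
    using assms(8,9) order_trans by blast
  have 1: "cesaro_functional_eq \<alpha> T \<longleftrightarrow> cesaro_recurrence \<alpha> T"
    by (rule cesaro_functional_eq_iff_recurrence[of \<alpha> T, OF \<alpha> T0])
  have 2: "(\<exists>\<theta>. represents \<alpha> \<phi> T \<theta>) \<longleftrightarrow> cesaro_recurrence \<alpha> T"
    using 1 represents_extension represents_imp_recurrence by blast
  have 3: "pseudo_resolvent {z. cmod z > a} (cesaro_resolvent \<alpha> T) \<longleftrightarrow> cesaro_recurrence \<alpha> T"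
    using pseudo_resolvent_imp_cesaro_recurrence[of \<alpha> a T, OF \<alpha> \<open>a > 1\<close> T0 bound]
      cesaro_recurrence_imp_pseudo_resolvent[of \<alpha> a T, OF \<alpha> \<open>a > 1\<close> T T0 bound] by blast
  define S where "S = T 1 - \<alpha> *\<^sub>R id_blinfun"
  have 4: "z \<in> resolvent_set S \<and> cesaro_resolvent \<alpha> T z = inv (\<lambda>x. z *\<^sub>C x - S x)"
    if rec: "cesaro_recurrence \<alpha> T" and z: "cmod z > a" for z
  proof -
    obtain R where R: "R \<in> bounded_ops" "cesaro_resolvent \<alpha> T z = blinfun_apply R"
      "\<And>x. S (R x) = z *\<^sub>C R x - x" "\<And>x. R (S x) = z *\<^sub>C R x - x"
      using cesaro_resolvent_inverse[of \<alpha> a T, OF \<alpha> \<open>a > 1\<close> T T0 bound rec z] unfolding S_def by blast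
    have left: "R (z *\<^sub>C x - S x) = x" for x
      using R(1) by (simp add: bounded_ops_def blinfun.diff_right R(4))
    have right: "z *\<^sub>C R x - S (R x) = x" for x
      by (simp add: R(3))
    have "z \<in> resolvent_set S"
      unfolding resolvent_set_def using R(1) left right by blast
    \<comment> \<open>\<open>inv\<close> is defined by choice; having both composites equal to the
      identity pins it down as \<open>R\<close>.\<close>
    moreover have "inv (\<lambda>x. z *\<^sub>C x - S x) = blinfun_apply R"
      by (rule inv_unique_comp) (simp_all add: fun_eq_iff left right)
    ultimately show ?thesis using R(2) by simp
  qed
  show ?thesis
    \<comment> \<open>Each of the three conditions becomes the recurrence, so only the consequences
      of the recurrence remain.\<close>
    unfolding 1 2 3 Let_def S_def[symmetric]
    using cesaro_recurrence_cesaro_sum[of \<alpha> T, OF \<alpha> T0, folded S_def]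
      represents_unit_seq_1[folded S_def] 4 by blast
qed

end
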